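(* Let $\{(x^{k},y^{k},z^{k})\}$ be a sequence generated by the IEIDP-ADMM with criterion (C2') (both defined in the context), where $\max(\mu_k^2,\nu_{k}^2)\le\min\big(\frac{1}{8\gamma},\frac{2-\tau-2.5\gamma^{-1}}{3\gamma}\big)$ for all $k\ge 1$ and some constant $\gamma\ge 360$. Suppose that Assumption A (see the context) holds and that, in addition to $\mathcal{T}_f\succ 0$ and $\mathcal{T}_g\succ 0$, the operators $\mathcal{P}_f$ and $\mathcal{P}_g$ satisfy $\mathcal{P}_f+\frac{3}{8}\Sigma_f\succeq 0$ and $\mathcal{P}_g+\frac{3}{8}\Sigma_g\succeq 0$. Suppose that either (a) $\tau\in(0,1.6]$, or (b) $\tau\in(1.6,2)$ and $\sum_{k=0}^{\infty}\Big(|2.6-1.6\tau|\,\|h(x^{k},y^{k})\|^2+c_2\|y^{k+1}-y^k\|_{\mathcal{T}_g}^2\Big)<\infty$, where $c_2=\Big|2-\tau-6.5\gamma^{-1}-\frac{\max(1-\tau,\,(\tau-1)/1.6)}{1-10\gamma^{-1}}\Big|$. Then the sequence $\{(x^{k},y^{k})\}$ converges to an optimal solution of problem (P), and the sequence $\{z^{k}\}$ converges to an optimal solution of the dual problem of (P).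
   Context: Setting. $\mathbb{X},\mathbb{Y},\mathbb{Z}$ are finite-dimensional real vector spaces with inner product $\langle\cdot,\cdot\rangle$ and induced norm $\|\cdot\|$; $f:\mathbb{X}\to(-\infty,+\infty]$ and $g:\mathbb{Y}\to(-\infty,+\infty]$ are closed proper convex functions; $\mathcal{A}:\mathbb{Z}\to\mathbb{X}$, $\mathcal{B}:\mathbb{Z}\to\mathbb{Y}$ are linear operators with adjoints $\mathcal{A}^*,\mathcal{B}^*$; $c\in\mathbb{Z}$. Problem (P): $\min_{x\in\mathbb{X},y\in\mathbb{Y}} f(x)+g(y)$ subject to $\mathcal{A}^*x+\mathcal{B}^*y=c$. Its dual is the Lagrangian dual $\max_{z\in\mathbb{Z}}\ -f^*(-\mathcal{A}z)-g^*(-\mathcal{B}z)-\langle c,z\rangle$, with $f^*,g^*$ the convex conjugates. Write $h(x,y):=\mathcal{A}^*x+\mathcal{B}^*y-c$. Notation. For self-adjoint $\mathcal{T}$, $\mathcal{T}\succeq0$ ($\succ0$) means positive semidefinite (definite), $\mathcal{S}\preceq\mathcal{T}$ means $\mathcal{T}-\mathcal{S}\succeq0$, and $\|x\|_{\mathcal{T}}^2:=\langle x,\mathcal{T}x\rangle$ (this expression is used also for indefinite $\mathcal{T}$); for $\mathcal{T}\succeq 0$, $\|x\|_{\mathcal{T}}:=\sqrt{\langle x,\mathcal{T}x\rangle}$. For $\mathcal{T}\succ0$, $D_{\mathcal{T}}(x,\Omega):=\min_{u\in\Omega}\|u-x\|_{\mathcal{T}}$ is the distance to a nonempty closed set $\Omega$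 (conditions on $D_{\mathcal{T}}(0,\partial\phi)$ include nonemptiness of the subdifferential). $\partial$ denotes the convex subdifferential of the function. Operators $\Sigma_f,\Sigma_g$. $\Sigma_f\succeq0$ on $\mathbb{X}$ and $\Sigma_g\succeq0$ on $\mathbb{Y}$ are fixed self-adjoint operators such that for all $x,\tilde x\in\mathrm{dom} f$, $u\in\partial f(x)$, $\tilde u\in\partial f(\tilde x)$: $f(x)\ge f(\tilde x)+\langle\tilde u,x-\tilde x\rangle+\frac12\|x-\tilde x\|^2_{\Sigma_f}$ and $\langle u-\tilde u,x-\tilde x\rangle\ge\|x-\tilde x\|^2_{\Sigma_f}$; and for all $y,\tilde y\in\mathrm{dom} g$, $v\in\partial g(y)$, $\tilde v\in\partial g(\tilde y)$: $g(y)\ge g(\tilde y)+\langle\tilde v,y-\tilde y\rangle+\frac12\|y-\tilde y\|^2_{\Sigma_g}$ and $\langle v-\tilde v,y-\tilde y\rangle\ge\|y-\tilde y\|^2_{\Sigma_g}$. Assumption A. Problem (P) has an optimal solution $(x^*,y^* )\in\mathrm{dom} f\times\mathrm{dom} g$, and there is $(\hat x,\hat y)\in\mathrm{ri}(\mathrm{dom} f\times\mathrm{dom} g)$ with $\mathcal{A}^*\hat x+\mathcal{B}^*\hat y=c$. Algorithm (IEIDP-ADMM). Let $\sigma,\tau>0$, and let $L_\sigma(x,y,z):=f(x)+g(y)+\langle z,\mathcal{A}^*x+\mathcal{B}^*y-c\rangle+\frac{\sigma}{2}\|\mathcal{A}^*x+\mathcal{B}^*y-c\|^2$. Choose self-adjoint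 (possibly indefinite) operators $\mathcal{P}_f:\mathbb{X}\to\mathbb{X}$, $\mathcal{P}_g:\mathbb{Y}\to\mathbb{Y}$ with $\mathcal{T}_f:=\mathcal{P}_f+\Sigma_f+\sigma\mathcal{A}\mathcal{A}^*\succ0$ and $\mathcal{T}_g:=\mathcal{P}_g+\Sigma_g+\sigma\mathcal{B}\mathcal{B}^*\succ0$, and $(x^0,y^0,z^0)\in\mathrm{dom} f\times\mathrm{dom} g\times\mathbb{Z}$. For $k=0,1,2,\dots$: $x^{k+1}$ is an approximate minimizer of $\phi_k(x):=L_\sigma(x,y^k,z^k)+\frac12\|x-x^k\|^2_{\mathcal{P}_f}$; $y^{k+1}$ is an approximate minimizer of $\psi_k(y):=L_\sigma(x^{k+1},y,z^k)+\frac12\|y-y^k\|^2_{\mathcal{P}_g}$; and $z^{k+1}=z^k+\tau\sigma(\mathcal{A}^*x^{k+1}+\mathcal{B}^*y^{k+1}-c)$. Criterion (C2'). With nonnegative sequences $\{\mu_k\}_{k\ge1},\{\nu_k\}_{k\ge1}$ and self-adjoint positive definite operators $\mathcal{F}:\mathbb{X}\to\mathbb{X}$, $\mathcal{G}:\mathbb{Y}\to\mathbb{Y}$ satisfying $\mathcal{F}^{-1}\preceq\mathcal{T}_f$, $\mathcal{G}^{-1}\preceq\mathcal{T}_g$: for all $k\ge0$, $D_{\mathcal{F}}(0,\partial\phi_k(x^{k+1}))\le\mu_{k+1}\|x^{k+1}-x^k\|_{\mathcal{T}_f}$ and $D_{\mathcal{G}}(0,\partial\psi_k(y^{k+1}))\le\nu_{k+1}\|y^{k+1}-y^k\|_{\mathcal{T}_g}$,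 and $\sum_{k=0}^\infty\max(\mu_{k+1}^2,\nu_{k+1}^2)<\infty$. *)

theory Defs
  imports "HOL-Analysis.Analysis"
begin

section \<open>Self-adjoint operators\<close>

definition selfadj :: "('a::euclidean_space \<Rightarrow> 'a) \<Rightarrow> bool" where
  "selfadj T \<longleftrightarrow> linear T \<and> adjoint T = T"

definition psd :: "('a::euclidean_space \<Rightarrow> 'a) \<Rightarrow> bool" where
  "psd T \<longleftrightarrow> selfadj T \<and> (\<forall>x. 0 \<le> x \<bullet> T x)"

definition posdef :: "('a::euclidean_space \<Rightarrow> 'a) \<Rightarrow> bool" where
  "posdef T \<longleftrightarrow> selfadj T \<and> (\<forall>x. x \<noteq> 0 \<longrightarrow> 0 < x \<bullet> T x)"

definition loewner_le :: "('a::euclidean_space \<Rightarrow> 'a) \<Rightarrow> ('a \<Rightarrow> 'a) \<Rightarrow> bool" where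
  "loewner_le S T \<longleftrightarrow> psd (\<lambda>x. T x - S x)"

text \<open>The expression \<open>\<parallel>x\<parallel>\<^sub>T\<^sup>2\<close>, which is possibly negative when \<open>T\<close> is indefinite.\<close>

definition sqnorm_op :: "('a::euclidean_space \<Rightarrow> 'a) \<Rightarrow> 'a \<Rightarrow> real" where
  "sqnorm_op T x = x \<bullet> T x"

definition norm_op :: "('a::euclidean_space \<Rightarrow> 'a) \<Rightarrow> 'a \<Rightarrow> real" where
  "norm_op T x = sqrt (x \<bullet> T x)"

text \<open>For positive definite \<open>T\<close> and nonempty closed \<open>\<Omega>\<close> the infimum is attained. It is
  unspecified for \<open>\<Omega> = {}\<close>, so nonemptiness is required wherever this is used.\<close>

definition dist_op :: "('a::euclidean_space \<Rightarrow> 'a) \<Rightarrow> 'a \<Rightarrow> 'a set \<Rightarrow> real" where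
  "dist_op T x \<Omega> = (INF u\<in>\<Omega>. norm_op T (u - x))"

section \<open>Extended-real-valued convex functions\<close>

definition eff_dom :: "('a \<Rightarrow> ereal) \<Rightarrow> 'a set" where
  "eff_dom f = {x. f x < \<infinity>}"

definition epi :: "('a \<Rightarrow> ereal) \<Rightarrow> ('a \<times> real) set" where
  "epi f = {(x, r). f x \<le> ereal r}"

definition closed_proper_convex :: "('a::euclidean_space \<Rightarrow> ereal) \<Rightarrow> bool" where
  "closed_proper_convex f \<longleftrightarrow>
     (\<forall>x. f x \<noteq> -\<infinity>) \<and> eff_dom f \<noteq> {} \<and> convex (epi f) \<and> closed (epi f)"

definition subdiff :: "('a::euclidean_space \<Rightarrow> ereal) \<Rightarrow> 'a \<Rightarrow> 'a set" where
  "subdiff f x =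
     {u. \<bar>f x\<bar> \<noteq> \<infinity> \<and> (\<forall>w. f x + ereal (u \<bullet> (w - x)) \<le> f w)}"

definition conjugate :: "('a::euclidean_space \<Rightarrow> ereal) \<Rightarrow> 'a \<Rightarrow> ereal" where
  "conjugate f u = (SUP x. ereal (u \<bullet> x) - f x)"

definition convexity_operator ::
  "('a::euclidean_space \<Rightarrow> ereal) \<Rightarrow> ('a \<Rightarrow> 'a) \<Rightarrow> bool" where
  "convexity_operator f \<Sigma> \<longleftrightarrow> psd \<Sigma> \<and>
     (\<forall>x\<in>eff_dom f. \<forall>x'\<in>eff_dom f. \<forall>u\<in>subdiff f x. \<forall>u'\<in>subdiff f x'.
        f x \<ge> f x' + ereal (u' \<bullet> (x - x') + 1/2 * sqnorm_op \<Sigma> (x - x')) \<and>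
        (u - u') \<bullet> (x - x') \<ge> sqnorm_op \<Sigma> (x - x'))"

section \<open>The primal problem and its Lagrangian dual\<close>

definition residual ::
  "('z::euclidean_space \<Rightarrow> 'x::euclidean_space) \<Rightarrow> ('z \<Rightarrow> 'y::euclidean_space) \<Rightarrow> 'z \<Rightarrow>
   'x \<Rightarrow> 'y \<Rightarrow> 'z" where
  "residual A B c x y = adjoint A x + adjoint B y - c"

definition primal_optimal ::
  "('x::euclidean_space \<Rightarrow> ereal) \<Rightarrow> ('y::euclidean_space \<Rightarrow> ereal) \<Rightarrow>
   ('z::euclidean_space \<Rightarrow> 'x) \<Rightarrow> ('z \<Rightarrow> 'y) \<Rightarrow> 'z \<Rightarrow> 'x \<Rightarrow> 'y \<Rightarrow> bool" where
  "primal_optimal f g A B c x y \<longleftrightarrow>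
     x \<in> eff_dom f \<and> y \<in> eff_dom g \<and> adjoint A x + adjoint B y = c \<and>
     (\<forall>x' y'. adjoint A x' + adjoint B y' = c \<longrightarrow> f x + g y \<le> f x' + g y')"

definition dual_objective ::
  "('x::euclidean_space \<Rightarrow> ereal) \<Rightarrow> ('y::euclidean_space \<Rightarrow> ereal) \<Rightarrow>
   ('z::euclidean_space \<Rightarrow> 'x) \<Rightarrow> ('z \<Rightarrow> 'y) \<Rightarrow> 'z \<Rightarrow> 'z \<Rightarrow> ereal" where
  "dual_objective f g A B c z =
     - conjugate f (- A z) - conjugate g (- B z) - ereal (c \<bullet> z)"

text \<open>The first conjunct is dual feasibility: a point with objective value \<open>-\<infinity>\<close>
  is not regarded as a dual solution.\<close>

definition dual_optimal ::
  "('x::euclidean_space \<Rightarrow> ereal) \<Rightarrow> ('y::euclidean_space \<Rightarrow> ereal) \<Rightarrow>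
   ('z::euclidean_space \<Rightarrow> 'x) \<Rightarrow> ('z \<Rightarrow> 'y) \<Rightarrow> 'z \<Rightarrow> 'z \<Rightarrow> bool" where
  "dual_optimal f g A B c z \<longleftrightarrow>
     dual_objective f g A B c z > -\<infinity> \<and>
     (\<forall>z'. dual_objective f g A B c z' \<le> dual_objective f g A B c z)"

definition assumption_A ::
  "('x::euclidean_space \<Rightarrow> ereal) \<Rightarrow> ('y::euclidean_space \<Rightarrow> ereal) \<Rightarrow>
   ('z::euclidean_space \<Rightarrow> 'x) \<Rightarrow> ('z \<Rightarrow> 'y) \<Rightarrow> 'z \<Rightarrow> bool" where
  "assumption_A f g A B c \<longleftrightarrow>
     (\<exists>x y. primal_optimal f g A B c x y) \<and>
     (\<exists>x y. (x, y) \<in> rel_interior (eff_dom f \<times> eff_dom g) \<and>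
            adjoint A x + adjoint B y = c)"

section \<open>The inexact indefinite proximal ADMM\<close>

definition aug_lagrangian ::
  "('x::euclidean_space \<Rightarrow> ereal) \<Rightarrow> ('y::euclidean_space \<Rightarrow> ereal) \<Rightarrow>
   ('z::euclidean_space \<Rightarrow> 'x) \<Rightarrow> ('z \<Rightarrow> 'y) \<Rightarrow> 'z \<Rightarrow> real \<Rightarrow> 'x \<Rightarrow> 'y \<Rightarrow> 'z \<Rightarrow> ereal" where
  "aug_lagrangian f g A B c \<sigma> x y z =
     f x + g y + ereal (z \<bullet> residual A B c x y + \<sigma> / 2 * (norm (residual A B c x y))\<^sup>2)"

definition prox_op ::
  "('a::euclidean_space \<Rightarrow> 'a) \<Rightarrow> ('a \<Rightarrow> 'a) \<Rightarrow> real \<Rightarrow> ('z::euclidean_space \<Rightarrow> 'a) \<Rightarrow> 'a \<Rightarrow> 'a"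
  where "prox_op P \<Sigma> \<sigma> A = (\<lambda>x. P x + \<Sigma> x + \<sigma> *\<^sub>R A (adjoint A x))"

definition x_objective ::
  "('x::euclidean_space \<Rightarrow> ereal) \<Rightarrow> ('y::euclidean_space \<Rightarrow> ereal) \<Rightarrow>
   ('z::euclidean_space \<Rightarrow> 'x) \<Rightarrow> ('z \<Rightarrow> 'y) \<Rightarrow> 'z \<Rightarrow> real \<Rightarrow> ('x \<Rightarrow> 'x) \<Rightarrow>
   'x \<Rightarrow> 'y \<Rightarrow> 'z \<Rightarrow> 'x \<Rightarrow> ereal" where
  "x_objective f g A B c \<sigma> Pf xk yk zk =
     (\<lambda>x. aug_lagrangian f g A B c \<sigma> x yk zk + ereal (1/2 * sqnorm_op Pf (x - xk)))"

definition y_objective ::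
  "('x::euclidean_space \<Rightarrow> ereal) \<Rightarrow> ('y::euclidean_space \<Rightarrow> ereal) \<Rightarrow>
   ('z::euclidean_space \<Rightarrow> 'x) \<Rightarrow> ('z \<Rightarrow> 'y) \<Rightarrow> 'z \<Rightarrow> real \<Rightarrow> ('y \<Rightarrow> 'y) \<Rightarrow>
   'x \<Rightarrow> 'y \<Rightarrow> 'z \<Rightarrow> 'y \<Rightarrow> ereal" where
  "y_objective f g A B c \<sigma> Pg xk1 yk zk =
     (\<lambda>y. aug_lagrangian f g A B c \<sigma> xk1 y zk + ereal (1/2 * sqnorm_op Pg (y - yk)))"

text \<open>Sequences generated by the algorithm with criterion (C2'). The sense in which
  \<open>x (Suc k)\<close> and \<open>y (Suc k)\<close> are approximate minimizers of the two subproblem objectives is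
  exactly the pair of subdifferential distance bounds. The entries \<open>\<mu> 0\<close> and \<open>\<nu> 0\<close> are
  never used.\<close>

definition ieidp_admm_C2' ::
  "('x::euclidean_space \<Rightarrow> ereal) \<Rightarrow> ('y::euclidean_space \<Rightarrow> ereal) \<Rightarrow>
   ('z::euclidean_space \<Rightarrow> 'x) \<Rightarrow> ('z \<Rightarrow> 'y) \<Rightarrow> 'z \<Rightarrow> real \<Rightarrow> real \<Rightarrow>
   ('x \<Rightarrow> 'x) \<Rightarrow> ('y \<Rightarrow> 'y) \<Rightarrow> ('x \<Rightarrow> 'x) \<Rightarrow> ('y \<Rightarrow> 'y) \<Rightarrow> ('x \<Rightarrow> 'x) \<Rightarrow> ('y \<Rightarrow> 'y) \<Rightarrow>
   (nat \<Rightarrow> real) \<Rightarrow> (nat \<Rightarrow> real) \<Rightarrow> (nat \<Rightarrow> 'x) \<Rightarrow> (nat \<Rightarrow> 'y) \<Rightarrow> (nat \<Rightarrow> 'z) \<Rightarrow> bool" where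
  "ieidp_admm_C2' f g A B c \<sigma> \<tau> \<Sigma>f \<Sigma>g Pf Pg F G \<mu> \<nu> x y z \<longleftrightarrow>
     (let Tf = prox_op Pf \<Sigma>f \<sigma> A; Tg = prox_op Pg \<Sigma>g \<sigma> B;
          \<phi> = (\<lambda>k. x_objective f g A B c \<sigma> Pf (x k) (y k) (z k));
          \<psi> = (\<lambda>k. y_objective f g A B c \<sigma> Pg (x (Suc k)) (y k) (z k))
      in
        0 < \<sigma> \<and> 0 < \<tau> \<and>
        selfadj Pf \<and> selfadj Pg \<and> posdef Tf \<and> posdef Tg \<and>
        x 0 \<in> eff_dom f \<and> y 0 \<in> eff_dom g \<and>
        (\<forall>k. z (Suc k) = z k + (\<tau> * \<sigma>) *\<^sub>R residual A B c (x (Suc k)) (y (Suc k))) \<and>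
        posdef F \<and> posdef G \<and> loewner_le (inv F) Tf \<and> loewner_le (inv G) Tg \<and>
        (\<forall>k\<ge>1. 0 \<le> \<mu> k \<and> 0 \<le> \<nu> k) \<and>
        (\<forall>k. subdiff (\<phi> k) (x (Suc k)) \<noteq> {} \<and>
             dist_op F 0 (subdiff (\<phi> k) (x (Suc k))) \<le> \<mu> (Suc k) * norm_op Tf (x (Suc k) - x k)) \<and>
        (\<forall>k. subdiff (\<psi> k) (y (Suc k)) \<noteq> {} \<and>
             dist_op G 0 (subdiff (\<psi> k) (y (Suc k))) \<le> \<nu> (Suc k) * norm_op Tg (y (Suc k) - y k)) \<and>
        summable (\<lambda>k. max ((\<mu> (Suc k))\<^sup>2) ((\<nu> (Suc k))\<^sup>2)))"

end

theory Submission
  imports Defs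
begin

text \<open>
  The proof is an energy argument. By strong duality there is a KKT point \<open>(xs, ys, zs)\<close>. Testing the
  optimality conditions of both subproblems against it, with monotonicity of the subdifferentials
  strengthened by \<open>\<Sigma>f\<close> and \<open>\<Sigma>g\<close>, shows that a weighted squared distance from the iterates to the
  KKT point decreases from step to step by squares of the residual and of the steps, except
  for two disturbances: a cross term between the new residual and the step in \<open>y\<close>, and the errors of the
  subproblem solutions (\<open>main_estimate\<close>). The strong monotonicity is what compensates the
  indefiniteness of \<open>Pf\<close> and \<open>Pg\<close>.

  The cross term is handled in one of three ways (\<open>cross_bound\<close>). For \<open>\<tau> \<le> 8/5\<close>,
  comparing two consecutive optimality conditions in \<open>y\<close> replaces the new residual by
  \<open>1 - \<tau>\<close> times the old one, after which Young's inequality absorbs the term as long as \<open>\<tau>\<close> stays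
  below the golden ratio. For \<open>8/5 < \<tau> < 2\<close> the summability hypothesis makes the squared residuals or the
  squared steps in \<open>y\<close> summable, because its two weights cannot vanish simultaneously, and
  Young's inequality then makes the term a summable error.

  The errors enter through inner products with the distance to the KKT point. They are split into a small
  multiple of the squared step, which the decrease absorbs, and a summable multiple of the energy
  itself. Thus the energy \<open>\<Psi>\<close> is almost decreasing (\<open>descent\<close>), so it
  converges and the steps and residuals tend to zero (\<open>almost_descent\<close>). Every cluster point
  of the bounded iterates is then a KKT point. Using a cluster point as the reference point, the energy converges and
  has limit zero along a subsequence, so the whole sequence converges to it
  (\<open>iterates_converge\<close>). A KKT point solves the primal and the dual problem.
\<close>

section \<open>Quadratic forms of self-adjoint operators\<close>

lemma selfadj_inner: "selfadj T \<Longrightarrow> T u \<bullet> v = u \<bullet> T v"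
  unfolding selfadj_def by (metis adjoint_works inner_commute)

lemma selfadj_linear: "selfadj T \<Longrightarrow> linear T"
  by (simp add: selfadj_def)

lemma inner_adjoint:
  fixes A :: "'z::euclidean_space \<Rightarrow> 'x::euclidean_space"
  shows "linear A \<Longrightarrow> A w \<bullet> v = w \<bullet> adjoint A v"
  by (metis adjoint_works inner_commute)

lemma sqnorm_op_diff:
  assumes "selfadj T"
  shows "sqnorm_op T (u - v) = sqnorm_op T u + sqnorm_op T v - 2 * (T u \<bullet> v)"
proof -
  have "linear T" using assms by (rule selfadj_linear)
  then show ?thesis
    using selfadj_inner[OF assms, of u v] selfadj_inner[OF assms, of v u]
    by (simp add: sqnorm_op_def linear_diff inner_diff inner_commute)
qed

lemma sqnorm_op_add:
  assumes "selfadj T"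
  shows "sqnorm_op T (u + v) = sqnorm_op T u + sqnorm_op T v + 2 * (T u \<bullet> v)"
proof -
  have "linear T" using assms by (rule selfadj_linear)
  then show ?thesis
    using selfadj_inner[OF assms, of u v] selfadj_inner[OF assms, of v u]
    by (simp add: sqnorm_op_def linear_add inner_add inner_commute)
qed

lemma sqnorm_op_three_point:
  assumes "selfadj T"
  shows "2 * (T (a - b) \<bullet> (a - s)) = sqnorm_op T (a - s) - sqnorm_op T (b - s) + sqnorm_op T (a - b)"
proof -
  have "b - s = (a - s) - (a - b)" by simp
  then have "sqnorm_op T (b - s) = sqnorm_op T (a - s) + sqnorm_op T (a - b) - 2 * (T (a - s) \<bullet> (a - b))"
    using sqnorm_op_diff[OF assms, of "a - s" "a - b"] by simp
  then show ?thesis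
    using selfadj_inner[OF assms, of "a - s" "a - b"] by (simp add: inner_commute)
qed

lemma psd_inner_le:
  assumes "psd T"
  shows "2 * (T u \<bullet> v) \<le> sqnorm_op T u + sqnorm_op T v"
proof -
  have "0 \<le> sqnorm_op T (u - v)" "selfadj T"
    using assms by (auto simp: psd_def sqnorm_op_def)
  then show ?thesis by (simp add: sqnorm_op_diff)
qed

lemma psd_diff_le:
  assumes "psd T"
  shows "sqnorm_op T (u - v) \<le> 2 * sqnorm_op T u + 2 * sqnorm_op T v"
proof -
  have "0 \<le> sqnorm_op T (u + v)" "selfadj T"
    using assms by (auto simp: psd_def sqnorm_op_def)
  then show ?thesis by (simp add: sqnorm_op_diff sqnorm_op_add)
qed

lemma posdef_nonneg: "posdef T \<Longrightarrow> 0 \<le> sqnorm_op T v"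
  by (cases "v = 0") (auto simp: posdef_def sqnorm_op_def less_imp_le)

lemma norm_op_power2: "posdef T \<Longrightarrow> (norm_op T v)\<^sup>2 = sqnorm_op T v"
  using posdef_nonneg[of T v] by (simp add: norm_op_def sqnorm_op_def)

text \<open>A positive definite quadratic form is bounded away from zero on the compact unit sphere.\<close>

lemma posdef_norm_bound:
  fixes T :: "'a::euclidean_space \<Rightarrow> 'a"
  assumes "posdef T"
  shows "\<exists>C>0. \<forall>v. (norm v)\<^sup>2 \<le> C * sqnorm_op T v"
proof -
  have lin: "linear T" using assms by (simp add: posdef_def selfadj_def)
  have "continuous_on (sphere 0 1) (\<lambda>v. v \<bullet> T v)"
    by (intro continuous_intros linear_continuous_on linear_linear[THEN iffD2] lin)
  moreover have "sphere (0::'a) 1 \<noteq> {}" by simp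
  ultimately obtain s where s: "norm s = 1" "\<And>v. norm v = 1 \<Longrightarrow> s \<bullet> T s \<le> v \<bullet> T v"
    using continuous_attains_inf[OF compact_sphere, of 0 1 "\<lambda>v. v \<bullet> T v"] by auto
  have pos: "0 < s \<bullet> T s" using assms s(1) unfolding posdef_def by (metis norm_zero zero_neq_one)
  have "(norm v)\<^sup>2 \<le> inverse (s \<bullet> T s) * sqnorm_op T v" for v
  proof (cases "v = 0")
    case True then show ?thesis using lin by (simp add: sqnorm_op_def)
  next
    case False
    define u where "u = v /\<^sub>R norm v"
    have u: "norm u = 1" "v = norm v *\<^sub>R u" using False by (auto simp: u_def)
    have "v \<bullet> T v = (norm v *\<^sub>R u) \<bullet> T (norm v *\<^sub>R u)" using u(2) by simp
    also have "\<dots> = (norm v)\<^sup>2 * (u \<bullet> T u)"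
      using lin by (simp add: linear_scale power2_eq_square)
    finally have "v \<bullet> T v = (norm v)\<^sup>2 * (u \<bullet> T u)" .
    moreover have "(norm v)\<^sup>2 * (s \<bullet> T s) \<le> (norm v)\<^sup>2 * (u \<bullet> T u)"
      by (rule mult_left_mono[OF s(2)[OF u(1)]]) simp
    ultimately show ?thesis using pos by (simp add: sqnorm_op_def field_simps)
  qed
  then show ?thesis using pos by (intro exI[of _ "inverse (s \<bullet> T s)"]) simp
qed

section \<open>Subdifferentials\<close>

lemma subdiff_monotone:
  assumes "convexity_operator f S" "u \<in> subdiff f x" "u' \<in> subdiff f x'"
  shows "sqnorm_op S (x - x') \<le> (u - u') \<bullet> (x - x')"
proof -
  have "x \<in> eff_dom f" "x' \<in> eff_dom f"
    using assms(2,3) by (auto simp: subdiff_def eff_dom_def)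
  then show ?thesis using assms by (auto simp: convexity_operator_def)
qed

lemma subdiff_closed:
  fixes f :: "'a::euclidean_space \<Rightarrow> ereal"
  shows "closed (subdiff f x)"
proof (cases "\<bar>f x\<bar> = \<infinity>")
  case False
  then obtain a where a: "f x = ereal a" by auto
  have "closed {u. f x + ereal (u \<bullet> (w - x)) \<le> f w}" for w
  proof (cases "f w")
    case (real b)
    then have "{u. f x + ereal (u \<bullet> (w - x)) \<le> f w} = {u. (w - x) \<bullet> u \<le> b - a}"
      using a by (auto simp: inner_commute algebra_simps)
    then show ?thesis by (simp add: closed_halfspace_le)
  qed (use a in auto)
  moreover have "subdiff f x = (\<Inter>w. {u. f x + ereal (u \<bullet> (w - x)) \<le> f w})"
    using False by (auto simp: subdiff_def)
  ultimately show ?thesis by auto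
qed (simp add: subdiff_def)

text \<open>Written in terms of the epigraph, the subgradient inequality at \<open>x n\<close> tested against a fixed
  point \<open>w\<close> says that \<open>(x n, f w - u n \<bullet> (w - x n))\<close> lies in \<open>epi f\<close>, and this
  survives the limit because \<open>epi f\<close> is closed.\<close>

lemma subdiff_closed_graph:
  fixes f :: "'a::euclidean_space \<Rightarrow> ereal"
  assumes f: "closed_proper_convex f"
    and u: "\<And>n. u n \<in> subdiff f (x n)" and ux: "u \<longlonglongrightarrow> u'" "x \<longlonglongrightarrow> x'"
  shows "u' \<in> subdiff f x'"
proof -
  have key: "f x' \<le> ereal (b - u' \<bullet> (w - x'))" if b: "f w = ereal b" for w b
  proof -
    have mem: "(x n, b - u n \<bullet> (w - x n)) \<in> epi f" for n
      using u[of n] b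
      by (cases "f (x n)") (auto simp: subdiff_def epi_def algebra_simps dest!: spec[of _ w])
    have lim: "(\<lambda>n. (x n, b - u n \<bullet> (w - x n))) \<longlonglongrightarrow> (x', b - u' \<bullet> (w - x'))"
      by (intro tendsto_intros ux)
    have "closed (epi f)" using f by (simp add: closed_proper_convex_def)
    from closed_sequentially[OF this mem lim] have "(x', b - u' \<bullet> (w - x')) \<in> epi f" .
    then show ?thesis by (simp add: epi_def)
  qed
  have fnm: "f w \<noteq> -\<infinity>" for w using f by (simp add: closed_proper_convex_def)
  obtain w0 where "f w0 < \<infinity>" using f by (auto simp: closed_proper_convex_def eff_dom_def)
  then obtain b0 where "f w0 = ereal b0" using fnm[of w0] by (cases "f w0") auto
  from key[OF this] have fin: "\<bar>f x'\<bar> \<noteq> \<infinity>" using fnm[of x'] by auto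
  then obtain a where a: "f x' = ereal a" by auto
  have "f x' + ereal (u' \<bullet> (w - x')) \<le> f w" for w
    using key[of w] fnm[of w] a by (cases "f w") (auto simp: algebra_simps)
  then show ?thesis using fin by (auto simp: subdiff_def)
qed

text \<open>A subgradient of \<open>f + q\<close> with \<open>q\<close> quadratic, and not necessarily convex, yields a
  subgradient of \<open>f\<close> after removing the gradient of \<open>q\<close>: along the segment from \<open>x\<close> to any
  other point the quadratic remainder is of second order, whereas convexity bounds the first-order
  slope of \<open>f\<close> by its increment over the whole segment.\<close>

lemma subdiff_minus_quadratic:
  fixes f :: "'a::euclidean_space \<Rightarrow> ereal"
  assumes f: "closed_proper_convex f"
    and d: "d \<in> subdiff (\<lambda>v. f v + ereal (q v)) x"
    and q: "\<And>v. q v = q x + a \<bullet> (v - x) + (v - x) \<bullet> H (v - x)"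
    and H: "linear H"
  shows "d - a \<in> subdiff f x"
proof -
  have fin: "\<bar>f x\<bar> \<noteq> \<infinity>" using d by (cases "f x") (auto simp: subdiff_def)
  then obtain \<alpha> where \<alpha>: "f x = ereal \<alpha>" by auto
  have fnm: "f w \<noteq> -\<infinity>" for w using f by (simp add: closed_proper_convex_def)
  have "\<alpha> + (d - a) \<bullet> (w - x) \<le> \<beta>" if \<beta>: "f w = ereal \<beta>" for w \<beta>
  proof -
    have slope: "(d - a) \<bullet> (w - x) - t * ((w - x) \<bullet> H (w - x)) \<le> \<beta> - \<alpha>"
      if t: "0 < t" "t \<le> 1" for t :: real
    proof -
      define v where "v = x + t *\<^sub>R (w - x)"
      have "(1 - t) *\<^sub>R (x, \<alpha>) + t *\<^sub>R (w, \<beta>) \<in> epi f"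
        using f t \<alpha> \<beta> unfolding closed_proper_convex_def
        by (intro convexD_alt) (auto simp: epi_def)
      then have ub: "f v \<le> ereal (\<alpha> + t * (\<beta> - \<alpha>))"
        by (simp add: epi_def v_def algebra_simps)
      then obtain r where r: "f v = ereal r" using fnm[of v] by (cases "f v") auto
      have "f x + ereal (q x) + ereal (d \<bullet> (v - x)) \<le> f v + ereal (q v)"
        using d by (auto simp: subdiff_def)
      then have "\<alpha> + q x + d \<bullet> (v - x) \<le> r + q v" using \<alpha> r by simp
      moreover have "q v = q x + t * (a \<bullet> (w - x)) + t * (t * ((w - x) \<bullet> H (w - x)))"
        by (subst q) (simp add: v_def linear_scale[OF H])
      moreover have "d \<bullet> (v - x) = t * (d \<bullet> (w - x))" by (simp add: v_def)
      moreover have "r \<le> \<alpha> + t * (\<beta> - \<alpha>)" using ub r by simp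
      ultimately have "t * ((d - a) \<bullet> (w - x) - t * ((w - x) \<bullet> H (w - x))) \<le> t * (\<beta> - \<alpha>)"
        by (simp add: algebra_simps inner_diff_left)
      then show ?thesis using t by simp
    qed
    have "((\<lambda>t. (d - a) \<bullet> (w - x) - t * ((w - x) \<bullet> H (w - x))) \<longlongrightarrow>
        (d - a) \<bullet> (w - x) - 0 * ((w - x) \<bullet> H (w - x))) (at_right 0)"
      by (intro tendsto_intros)
    moreover have "eventually (\<lambda>t. (d - a) \<bullet> (w - x) - t * ((w - x) \<bullet> H (w - x)) \<le> \<beta> - \<alpha>)
        (at_right (0::real))"
      by (rule eventually_at_rightI[of 0 1]) (auto intro!: slope)
    ultimately have "(d - a) \<bullet> (w - x) - 0 * ((w - x) \<bullet> H (w - x)) \<le> \<beta> - \<alpha>"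
      by (rule tendsto_upperbound) simp
    then show ?thesis by simp
  qed
  then have "f x + ereal ((d - a) \<bullet> (w - x)) \<le> f w" for w
    using \<alpha> fnm[of w] by (cases "f w") auto
  then show ?thesis using fin by (auto simp: subdiff_def)
qed

text \<open>The element of least Euclidean norm serves all metrics at once, up to the constant that
  compares the norms.\<close>

lemma short_subgradient:
  fixes \<phi> :: "'a::euclidean_space \<Rightarrow> ereal"
  assumes ne: "subdiff \<phi> x \<noteq> {}" and F: "posdef F"
    and C: "C > 0" "\<And>v. (norm v)\<^sup>2 \<le> C * sqnorm_op F v"
    and le: "dist_op F 0 (subdiff \<phi> x) \<le> b"
  obtains d where "d \<in> subdiff \<phi> x" "(norm d)\<^sup>2 \<le> C * b\<^sup>2"
proof -
  obtain d where d: "d \<in> subdiff \<phi> x" "\<And>u. u \<in> subdiff \<phi> x \<Longrightarrow> norm d \<le> norm u"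
    using distance_attains_inf[OF subdiff_closed ne, of 0] by auto
  have "norm d / sqrt C \<le> norm_op F (u - 0)" if "u \<in> subdiff \<phi> x" for u
  proof -
    have "norm d \<le> sqrt (C * sqnorm_op F u)"
      using d(2)[OF that] C(2)[of u] by (meson norm_ge_zero order_trans real_le_rsqrt)
    then show ?thesis
      using C(1) by (simp add: norm_op_def sqnorm_op_def real_sqrt_mult field_simps)
  qed
  then have "norm d / sqrt C \<le> dist_op F 0 (subdiff \<phi> x)"
    unfolding dist_op_def using ne by (intro cINF_greatest)
  then have "norm d / sqrt C \<le> b" using le by simp
  then have "(norm d / sqrt C)\<^sup>2 \<le> b\<^sup>2" using C(1) by (intro power_mono) auto
  then have "(norm d)\<^sup>2 \<le> C * b\<^sup>2" using C(1) by (simp add: power_divide field_simps)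
  then show ?thesis using that d(1) by blast
qed

section \<open>Karush-Kuhn-Tucker points and duality\<close>

definition kkt_point ::
  "('x::euclidean_space \<Rightarrow> ereal) \<Rightarrow> ('y::euclidean_space \<Rightarrow> ereal) \<Rightarrow>
   ('z::euclidean_space \<Rightarrow> 'x) \<Rightarrow> ('z \<Rightarrow> 'y) \<Rightarrow> 'z \<Rightarrow> 'x \<Rightarrow> 'y \<Rightarrow> 'z \<Rightarrow> bool" where
  "kkt_point f g A B c x y z \<longleftrightarrow>
     - A z \<in> subdiff f x \<and> - B z \<in> subdiff g y \<and> residual A B c x y = 0"

lemma subdiff_conjugate:
  assumes "u \<in> subdiff f x" "f x = ereal a"
  shows "conjugate f u = ereal (u \<bullet> x - a)"
  unfolding conjugate_def
proof (rule antisym)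
  show "(SUP w. ereal (u \<bullet> w) - f w) \<le> ereal (u \<bullet> x - a)"
  proof (rule SUP_least)
    fix w
    have "f x + ereal (u \<bullet> (w - x)) \<le> f w" using assms(1) by (simp add: subdiff_def)
    then show "ereal (u \<bullet> w) - f w \<le> ereal (u \<bullet> x - a)"
      using assms(2) by (cases "f w") (auto simp: inner_diff_right)
  qed
  show "ereal (u \<bullet> x - a) \<le> (SUP w. ereal (u \<bullet> w) - f w)"
    by (rule SUP_upper2[of x]) (use assms(2) in auto)
qed

lemma conjugate_ge: "f x = ereal a \<Longrightarrow> ereal (u \<bullet> x - a) \<le> conjugate f u"
  unfolding conjugate_def by (rule SUP_upper2[of x]) auto

lemma kkt_point_optimal:
  fixes A :: "'z::euclidean_space \<Rightarrow> 'x::euclidean_space"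
    and B :: "'z \<Rightarrow> 'y::euclidean_space"
  assumes A: "linear A" and B: "linear B" and kkt: "kkt_point f g A B c x y z"
  shows "primal_optimal f g A B c x y" "dual_optimal f g A B c z"
proof -
  have sub: "- A z \<in> subdiff f x" "- B z \<in> subdiff g y"
    and feas: "adjoint A x + adjoint B y = c"
    using kkt by (auto simp: kkt_point_def residual_def)
  obtain a b where ab: "f x = ereal a" "g y = ereal b"
    using sub by (cases "f x"; cases "g y") (auto simp: subdiff_def)
  have pair: "A w \<bullet> x' + B w \<bullet> y' = w \<bullet> (adjoint A x' + adjoint B y')" for w x' y'
    by (simp add: inner_adjoint[OF A] inner_adjoint[OF B] inner_add_right)
  have primal: "f x + g y \<le> f x' + g y'" if x': "adjoint A x' + adjoint B y' = c" for x' y'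
  proof -
    have "A z \<bullet> x' + B z \<bullet> y' = A z \<bullet> x + B z \<bullet> y" by (simp add: pair feas x')
    moreover have "f x + ereal (- A z \<bullet> (x' - x)) \<le> f x'" "g y + ereal (- B z \<bullet> (y' - y)) \<le> g y'"
      using sub by (auto simp: subdiff_def)
    ultimately show ?thesis using ab
      by (cases "f x'"; cases "g y'") (auto simp: inner_diff_right)
  qed
  then show "primal_optimal f g A B c x y"
    using ab feas by (auto simp: primal_optimal_def eff_dom_def)
  have val: "dual_objective f g A B c z = ereal (a + b)"
  proof -
    have "A z \<bullet> x + B z \<bullet> y = c \<bullet> z" unfolding pair feas by (rule inner_commute)
    then show ?thesis
      using subdiff_conjugate[OF sub(1) ab(1)] subdiff_conjugate[OF sub(2) ab(2)]
      by (simp add: dual_objective_def)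
  qed
  have "dual_objective f g A B c w \<le> ereal (a + b)" for w
  proof -
    have "A w \<bullet> x + B w \<bullet> y = c \<bullet> w" unfolding pair feas by (rule inner_commute)
    then show ?thesis
      using conjugate_ge[of f x a "- A w"] conjugate_ge[of g y b "- B w"] ab
      by (cases "conjugate f (- A w)"; cases "conjugate g (- B w)")
         (auto simp: dual_objective_def)
  qed
  then show "dual_optimal f g A B c z" by (auto simp: dual_optimal_def val)
qed

lemma convex_eff_dom:
  assumes "closed_proper_convex f"
  shows "convex (eff_dom f)"
proof -
  have "x \<in> fst ` epi f" if "x \<in> eff_dom f" for x
  proof -
    have "f x \<noteq> \<infinity>" "f x \<noteq> -\<infinity>"
      using that assms by (auto simp: eff_dom_def closed_proper_convex_def)
    then obtain a where "f x = ereal a" by (cases "f x") auto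
    then show ?thesis by (intro image_eqI[of _ _ "(x, a)"]) (auto simp: epi_def)
  qed
  moreover have "fst ` epi f \<subseteq> eff_dom f"
    by (auto simp: eff_dom_def epi_def intro: le_less_trans)
  ultimately have "eff_dom f = fst ` epi f" by blast
  then show ?thesis
    using assms by (simp add: closed_proper_convex_def convex_linear_image linear_fst)
qed

text \<open>Strong duality together with dual attainment. The set \<open>S\<close> collects the pairs (constraint
  violation, excess over the optimal value) that are reachable. Optimality keeps the negative
  vertical axis out of \<open>S\<close>, so the origin is not in its relative interior and a hyperplane
  with normal \<open>h = (u, \<alpha>)\<close> supports \<open>S\<close> there properly. The hyperplane is not vertical: if
  \<open>\<alpha> = 0\<close>, then \<open>u\<close> would be nonnegative on all constraint violations and positive on one
  of them, but a feasible point in the relative interior of the domain can be moved slightly past itself,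
  away from the violating point, which gives a violation of the opposite sign.
  The multiplier is then \<open>u / \<alpha>\<close>.\<close>

lemma kkt_point_exists:
  fixes f :: "'x::euclidean_space \<Rightarrow> ereal" and g :: "'y::euclidean_space \<Rightarrow> ereal"
    and A :: "'z::euclidean_space \<Rightarrow> 'x" and B :: "'z \<Rightarrow> 'y"
  assumes f: "closed_proper_convex f" and g: "closed_proper_convex g"
    and A: "linear A" and B: "linear B"
    and assm: "assumption_A f g A B c"
  obtains x y z where "kkt_point f g A B c x y z"
proof -
  obtain xs ys xh yh where opt: "primal_optimal f g A B c xs ys"
    and ri: "(xh, yh) \<in> rel_interior (eff_dom f \<times> eff_dom g)"
    and feash: "adjoint A xh + adjoint B yh = c"
    using assm by (auto simp: assumption_A_def)
  have fnm: "f w \<noteq> -\<infinity>" for w using f by (simp add: closed_proper_convex_def)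
  have gnm: "g w \<noteq> -\<infinity>" for w using g by (simp add: closed_proper_convex_def)
  have linA: "linear (adjoint A)" and linB: "linear (adjoint B)"
    using A B by (auto intro: adjoint_linear)
  have feas: "adjoint A xs + adjoint B ys = c" using opt by (simp add: primal_optimal_def)
  obtain p q where pq: "f xs = ereal p" "g ys = ereal q"
    using opt fnm[of xs] gnm[of ys]
    by (cases "f xs"; cases "g ys") (auto simp: primal_optimal_def eff_dom_def)
  define L :: "('x \<times> real) \<times> ('y \<times> real) \<Rightarrow> 'z \<times> real" where
    "L = (\<lambda>w. (adjoint A (fst (fst w)) + adjoint B (fst (snd w)), snd (fst w) + snd (snd w)))"
  define S where "S = (\<lambda>s. s - (c, p + q)) ` L ` (epi f \<times> epi g)"
  have "linear L"
    unfolding L_def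
    by (rule linearI) (auto simp: linear_add[OF linA] linear_add[OF linB]
        linear_scale[OF linA] linear_scale[OF linB] algebra_simps)
  then have "convex (L ` (epi f \<times> epi g))"
    using f g by (intro convex_linear_image convex_Times) (auto simp: closed_proper_convex_def)
  then have convS: "convex S" unfolding S_def by (rule convex_translation_subtract)
  have SI: "(adjoint A x + adjoint B y - c, a + b - p - q) \<in> S"
    if "f x \<le> ereal a" "g y \<le> ereal b" for x y a b
  proof -
    have "((x, a), (y, b)) \<in> epi f \<times> epi g" using that by (simp add: epi_def)
    then have "L ((x, a), (y, b)) - (c, p + q) \<in> S" unfolding S_def by blast
    then show ?thesis by (simp add: L_def algebra_simps)
  qed
  have zeroS: "0 \<in> S" using SI[of xs p ys q] pq feas by (simp add: zero_prod_def)
  have up: "(0, 1) \<in> S" using SI[of xs "p + 1" ys q] pq feas by simp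
  have nodown: "(0, r) \<notin> S" if "r < 0" for r
  proof
    assume "(0, r) \<in> S"
    then obtain x a y b where xy: "f x \<le> ereal a" "g y \<le> ereal b"
      and eq: "adjoint A x + adjoint B y = c" "r = a + b - (p + q)"
      by (auto simp: S_def L_def epi_def)
    have "f xs + g ys \<le> f x + g y" using opt eq(1) by (simp add: primal_optimal_def)
    also have "\<dots> \<le> ereal a + ereal b" using xy by (rule add_mono)
    finally show False using pq eq(2) that by simp
  qed
  have "0 \<notin> rel_interior S"
  proof
    assume "0 \<in> rel_interior S"
    then obtain e where "e > 1" "(1 - e) *\<^sub>R (0::'z, 1::real) + e *\<^sub>R 0 \<in> S"
      using convex_rel_interior_if2[OF convS] hull_inc[OF up] by blast
    then show False using nodown[of "1 - e"] by simp
  qed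
  then obtain h where h: "\<And>s. s \<in> S \<Longrightarrow> h \<bullet> 0 \<le> h \<bullet> s"
    "\<And>s. s \<in> rel_interior S \<Longrightarrow> h \<bullet> 0 < h \<bullet> s"
    using supporting_hyperplane_rel_boundary[OF convS zeroS] by metis
  define u where "u = fst h"
  define \<alpha> where "\<alpha> = snd h"
  have hs: "h \<bullet> s = u \<bullet> fst s + \<alpha> * snd s" for s
    by (simp add: u_def \<alpha>_def inner_prod_def)
  have "\<alpha> \<ge> 0" using h(1)[OF up] by (simp add: hs)
  moreover have "\<alpha> \<noteq> 0"
  proof
    assume \<alpha>: "\<alpha> = 0"
    obtain s where "s \<in> rel_interior S"
      using rel_interior_eq_empty[OF convS] zeroS by blast
    then have s: "s \<in> S" "h \<bullet> s > 0"
      using h(2)[of s] rel_interior_subset[of S] by auto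
    then obtain x a y b where xy: "f x \<le> ereal a" "g y \<le> ereal b"
      and eq: "fst s = adjoint A x + adjoint B y - c"
      by (auto simp: S_def L_def epi_def)
    have pos: "u \<bullet> (adjoint A x + adjoint B y - c) > 0" using s(2) eq by (simp add: hs \<alpha>)
    have "(x, y) \<in> eff_dom f \<times> eff_dom g"
      using xy by (auto simp: eff_dom_def intro: le_less_trans)
    moreover have "convex (eff_dom f \<times> eff_dom g)"
      by (intro convex_Times convex_eff_dom f g)
    ultimately obtain e where e: "e > 1"
      and mem: "(1 - e) *\<^sub>R (x, y) + e *\<^sub>R (xh, yh) \<in> eff_dom f \<times> eff_dom g"
      using convex_rel_interior_if2[OF _ ri] hull_inc[of "(x, y)" "eff_dom f \<times> eff_dom g" affine]
      by meson
    define x' where "x' = (1 - e) *\<^sub>R x + e *\<^sub>R xh"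
    define y' where "y' = (1 - e) *\<^sub>R y + e *\<^sub>R yh"
    have "f x' < \<infinity>" "g y' < \<infinity>" using mem by (auto simp: x'_def y'_def eff_dom_def)
    then obtain a' b' where "f x' = ereal a'" "g y' = ereal b'"
      using fnm[of x'] gnm[of y'] by (cases "f x'"; cases "g y'") auto
    then have "0 \<le> u \<bullet> (adjoint A x' + adjoint B y' - c)"
      using h(1)[OF SI[of x' a' y' b']] by (simp add: hs \<alpha>)
    also have "adjoint A x' + adjoint B y' - c =
        (1 - e) *\<^sub>R (adjoint A x + adjoint B y - c) + e *\<^sub>R (adjoint A xh + adjoint B yh - c)"
      unfolding x'_def y'_def linear_add[OF linA] linear_add[OF linB]
        linear_scale[OF linA] linear_scale[OF linB]
      by (simp add: algebra_simps)
    finally have "0 \<le> (1 - e) * (u \<bullet> (adjoint A x + adjoint B y - c))" by (simp add: feash)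
    then show False using e pos by (simp add: zero_le_mult_iff)
  qed
  ultimately have \<alpha>: "\<alpha> > 0" by simp
  define z where "z = u /\<^sub>R \<alpha>"
  have sep: "0 \<le> z \<bullet> (adjoint A x + adjoint B y - c) + (a + b - p - q)"
    if "f x = ereal a" "g y = ereal b" for x y a b
  proof -
    have "0 \<le> u \<bullet> (adjoint A x + adjoint B y - c) + \<alpha> * (a + b - p - q)"
      using h(1)[OF SI[of x a y b]] that by (simp add: hs)
    also have "\<dots> = \<alpha> * (z \<bullet> (adjoint A x + adjoint B y - c) + (a + b - p - q))"
      using \<alpha> by (simp add: z_def distrib_left)
    finally show ?thesis using \<alpha> by (simp add: zero_le_mult_iff)
  qed
  have "- A z \<in> subdiff f xs"
  proof -
    have "f xs + ereal (- A z \<bullet> (w - xs)) \<le> f w" for w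
    proof (cases "f w")
      case (real a)
      have "adjoint A w + adjoint B ys - c = adjoint A (w - xs)"
        by (simp add: linear_diff[OF linA] flip: feas)
      then have "0 \<le> A z \<bullet> (w - xs) + (a - p)"
        using sep[OF real pq(2)] by (simp add: inner_adjoint[OF A])
      then show ?thesis using real pq by simp
    qed (use fnm[of w] in auto)
    then show ?thesis using pq by (simp add: subdiff_def)
  qed
  moreover have "- B z \<in> subdiff g ys"
  proof -
    have "g ys + ereal (- B z \<bullet> (w - ys)) \<le> g w" for w
    proof (cases "g w")
      case (real b)
      have "adjoint A xs + adjoint B w - c = adjoint B (w - ys)"
        by (simp add: linear_diff[OF linB] flip: feas)
      then have "0 \<le> B z \<bullet> (w - ys) + (b - q)"
        using sep[OF pq(1) real] by (simp add: inner_adjoint[OF B])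
      then show ?thesis using real pq by simp
    qed (use gnm[of w] in auto)
    then show ?thesis using pq by (simp add: subdiff_def)
  qed
  ultimately show ?thesis using that feas by (simp add: kkt_point_def residual_def)
qed

section \<open>Limits of sequences\<close>

lemma tendsto_zero_squeeze:
  fixes a b :: "nat \<Rightarrow> real"
  assumes "b \<longlonglongrightarrow> 0" "\<And>k. 0 \<le> a k" "\<And>k. a k \<le> b k"
  shows "a \<longlonglongrightarrow> 0"
  using assms by (auto intro!: tendsto_sandwich[of "\<lambda>_. 0" a sequentially b 0])

lemma tendsto_zero_of_square:
  fixes v :: "nat \<Rightarrow> 'a::real_normed_vector"
  assumes "(\<lambda>k. (norm (v k))\<^sup>2) \<longlonglongrightarrow> 0"
  shows "v \<longlonglongrightarrow> 0"
  using tendsto_real_sqrt[OF assms] by (simp add: tendsto_norm_zero_iff)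

lemma tendsto_linear:
  fixes T :: "'a::euclidean_space \<Rightarrow> 'b::real_normed_vector"
  assumes "linear T" "(v \<longlongrightarrow> l) F"
  shows "((\<lambda>k. T (v k)) \<longlongrightarrow> T l) F"
  using assms by (simp add: bounded_linear.tendsto linear_conv_bounded_linear)

lemma tendsto_sqnorm_op:
  fixes T :: "'a::euclidean_space \<Rightarrow> 'a"
  assumes "linear T" "(v \<longlongrightarrow> l) F"
  shows "((\<lambda>k. sqnorm_op T (v k)) \<longlongrightarrow> sqnorm_op T l) F"
  unfolding sqnorm_op_def
  using assms by (intro tendsto_inner bounded_linear.tendsto[of T]) (auto simp: linear_conv_bounded_linear)

lemma posdef_tendsto_zero:
  fixes T :: "'a::euclidean_space \<Rightarrow> 'a"
  assumes "posdef T" "(\<lambda>k. sqnorm_op T (v k)) \<longlonglongrightarrow> 0"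
  shows "v \<longlonglongrightarrow> 0"
proof (rule tendsto_zero_of_square)
  obtain C where C: "\<forall>u. (norm u)\<^sup>2 \<le> C * sqnorm_op T u"
    using posdef_norm_bound[OF assms(1)] by blast
  show "(\<lambda>k. (norm (v k))\<^sup>2) \<longlonglongrightarrow> 0"
    by (rule tendsto_zero_squeeze[OF tendsto_mult_right_zero[OF assms(2), of C]]) (simp_all add: C)
qed

text \<open>The perturbations of the optimality conditions are bounded by their products with fixed
  vectors, which suffices in finite dimension.\<close>

lemma weakly_null_imp_null:
  fixes d :: "nat \<Rightarrow> 'a::euclidean_space" and b :: "nat \<Rightarrow> real"
  assumes "\<And>v. \<exists>C. \<forall>k. (d k \<bullet> v)\<^sup>2 \<le> C * b k" "b \<longlonglongrightarrow> 0"
  shows "d \<longlonglongrightarrow> 0"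
proof (rule tendsto_componentwise_iff[THEN iffD2], rule ballI)
  fix i :: 'a
  from assms(1)[of i] obtain C :: real where C: "\<forall>k. (d k \<bullet> i)\<^sup>2 \<le> C * b k" by blast
  have "(\<lambda>k. (norm (d k \<bullet> i))\<^sup>2) \<longlonglongrightarrow> 0"
    by (rule tendsto_zero_squeeze[OF tendsto_mult_right_zero[OF assms(2), of C]]) (simp_all add: C)
  then have "(\<lambda>k. d k \<bullet> i) \<longlonglongrightarrow> 0" by (rule tendsto_zero_of_square)
  then show "(\<lambda>k. d k \<bullet> i) \<longlonglongrightarrow> 0 \<bullet> i" by simp
qed

text \<open>Subtracting the partial sums of \<open>s\<close> makes \<open>\<Psi>\<close> decreasing and bounded below.\<close>

lemma summable_descent:
  fixes \<Psi> D s :: "nat \<Rightarrow> real"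
  assumes \<Psi>: "\<And>k. 0 \<le> \<Psi> k" and D: "\<And>k. 0 \<le> D k" and s: "summable s"
    and step: "\<And>k. \<Psi> (Suc k) + D k \<le> \<Psi> k + s k"
  shows "convergent \<Psi>" "D \<longlonglongrightarrow> 0"
proof -
  define U where "U k = \<Psi> k - (\<Sum>j<k. s j)" for k
  have s_lim: "(\<lambda>k. \<Sum>j<k. s j) \<longlonglongrightarrow> suminf s" using s by (rule summable_LIMSEQ)
  have dec: "U (Suc k) \<le> U k - D k" for k using step[of k] by (simp add: U_def)
  have "decseq U"
  proof (rule decseq_SucI)
    fix k show "U (Suc k) \<le> U k" using dec[of k] D[of k] by simp
  qed
  moreover have "\<exists>l. \<forall>k. l \<le> U k"
  proof -
    obtain M where M: "\<And>k. norm (\<Sum>j<k. s j) \<le> M"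
      using convergent_imp_Bseq[OF convergentI[OF s_lim]] by (auto simp: Bseq_def)
    have "- M \<le> U k" for k using M[of k] \<Psi>[of k] by (auto simp: U_def)
    then show ?thesis by blast
  qed
  ultimately obtain l where l: "U \<longlonglongrightarrow> l"
    using decseq_convergent by blast
  have "(\<lambda>k. U k + (\<Sum>j<k. s j)) \<longlonglongrightarrow> l + suminf s" by (intro tendsto_intros l s_lim)
  then show "convergent \<Psi>" by (auto simp: U_def convergent_def)
  have "(\<lambda>k. U k - U (Suc k)) \<longlonglongrightarrow> l - l" by (intro tendsto_diff l LIMSEQ_Suc)
  then have "(\<lambda>k. U k - U (Suc k)) \<longlonglongrightarrow> 0" by simp
  then show "D \<longlonglongrightarrow> 0"
    by (rule tendsto_zero_squeeze) (use D dec in \<open>auto simp: algebra_simps\<close>)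
qed

text \<open>From some index on, the growth factors \<open>1 / (1 - m k)\<close> have a bounded product because \<open>m\<close> is summable, so
  \<open>\<Psi>\<close> stays bounded. Then \<open>m k * \<Psi> (Suc k)\<close> is itself a summable perturbation.\<close>

lemma almost_descent:
  fixes \<Psi> D s m :: "nat \<Rightarrow> real"
  assumes \<Psi>: "\<And>k. 0 \<le> \<Psi> k" and D: "\<And>k. 0 \<le> D k"
    and s: "summable s" "\<And>k. 0 \<le> s k" and m: "summable m" "\<And>k. 0 \<le> m k"
    and step: "eventually (\<lambda>k. (1 - m k) * \<Psi> (Suc k) + D k \<le> \<Psi> k + s k) sequentially"
  shows "convergent \<Psi>" "D \<longlonglongrightarrow> 0"
proof -
  have "eventually (\<lambda>k. m k < 1/2) sequentially"
    using summable_LIMSEQ_zero[OF m(1)] by (rule order_tendstoD) simp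
  then obtain K where K: "\<And>k. k \<ge> K \<Longrightarrow> m k < 1/2"
    "\<And>k. k \<ge> K \<Longrightarrow> (1 - m k) * \<Psi> (Suc k) + D k \<le> \<Psi> k + s k"
    using step unfolding eventually_sequentially by (meson linorder_le_cases order_trans)
  define \<Psi>' where "\<Psi>' k = \<Psi> (k + K)" for k
  define D' where "D' k = D (k + K)" for k
  define m' where "m' k = m (k + K)" for k
  define s' where "s' k = s (k + K)" for k
  have m's: "summable m'" and s's: "summable s'"
    using m(1) s(1) by (simp_all add: m'_def[abs_def] s'_def[abs_def] summable_iff_shift)
  have nn: "0 \<le> \<Psi>' k" "0 \<le> D' k" "0 \<le> m' k" "0 \<le> s' k" "m' k < 1/2" for k
    using \<Psi> D m s K by (auto simp: \<Psi>'_def D'_def m'_def s'_def)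
  have st: "(1 - m' k) * \<Psi>' (Suc k) + D' k \<le> \<Psi>' k + s' k" for k
    using K(2)[of "k + K"] by (simp add: \<Psi>'_def D'_def m'_def s'_def)
  have grow: "\<Psi>' (Suc k) \<le> exp (2 * m' k) * (\<Psi>' k + s' k)" for k
  proof -
    have "1 \<le> (1 - m' k) * (1 + 2 * m' k)"
      using mult_nonneg_nonneg[of "m' k" "1 - 2 * m' k"] nn(3,5)[of k] by (simp add: algebra_simps)
    also have "\<dots> \<le> (1 - m' k) * exp (2 * m' k)"
      using nn(5)[of k] by (intro mult_left_mono exp_ge_add_one_self) auto
    finally have "\<Psi>' (Suc k) * 1 \<le> \<Psi>' (Suc k) * ((1 - m' k) * exp (2 * m' k))"
      using nn(1) by (intro mult_left_mono)
    also have "\<dots> = exp (2 * m' k) * ((1 - m' k) * \<Psi>' (Suc k))" by simp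
    also have "\<dots> \<le> exp (2 * m' k) * (\<Psi>' k + s' k)"
      using st[of k] nn(2)[of k] by (intro mult_left_mono) auto
    finally show ?thesis by simp
  qed
  have bound: "\<Psi>' k \<le> exp (2 * (\<Sum>j<k. m' j)) * (\<Psi>' 0 + (\<Sum>j<k. s' j))" for k
  proof (induction k)
    case (Suc k)
    let ?E = "exp (2 * (\<Sum>j<k. m' j))"
    have "1 \<le> ?E" using nn(3) by (simp add: sum_nonneg)
    then have "s' k \<le> ?E * s' k" using mult_right_mono[of 1 ?E "s' k"] nn(4)[of k] by simp
    then have "\<Psi>' k + s' k \<le> ?E * (\<Psi>' 0 + (\<Sum>j<Suc k. s' j))"
      using Suc by (simp add: algebra_simps)
    then have "\<Psi>' (Suc k) \<le> exp (2 * m' k) * (?E * (\<Psi>' 0 + (\<Sum>j<Suc k. s' j)))"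
      using order_trans[OF grow] by (meson exp_ge_zero mult_left_mono)
    also have "\<dots> = exp (2 * (\<Sum>j<Suc k. m' j)) * (\<Psi>' 0 + (\<Sum>j<Suc k. s' j))"
      by (simp add: distrib_left exp_add mult.assoc)
    finally show ?case .
  qed simp
  define M where "M = exp (2 * suminf m') * (\<Psi>' 0 + suminf s')"
  have M: "\<Psi>' k \<le> M" for k
  proof -
    have "(\<Sum>j<k. m' j) \<le> suminf m'" "(\<Sum>j<k. s' j) \<le> suminf s'"
      using nn m's s's by (auto intro!: sum_le_suminf)
    then have "exp (2 * (\<Sum>j<k. m' j)) * (\<Psi>' 0 + (\<Sum>j<k. s' j)) \<le> M"
      unfolding M_def using nn by (intro mult_mono add_mono) (auto intro!: add_nonneg_nonneg sum_nonneg)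
    then show ?thesis using bound[of k] by simp
  qed
  have "\<Psi>' (Suc k) + D' k \<le> \<Psi>' k + (s' k + m' k * M)" for k
    using st[of k] mult_left_mono[OF M nn(3), of k "Suc k"] by (simp add: algebra_simps)
  moreover have "summable (\<lambda>k. s' k + m' k * M)"
    by (intro summable_add s's summable_mult2 m's)
  ultimately have "convergent \<Psi>'" "D' \<longlonglongrightarrow> 0"
    using summable_descent[of \<Psi>' D' "\<lambda>k. s' k + m' k * M"] nn by auto
  then show "convergent \<Psi>" "D \<longlonglongrightarrow> 0"
    unfolding \<Psi>'_def[abs_def] D'_def[abs_def]
    by (simp_all add: convergent_ignore_initial_segment LIMSEQ_offset)
qed

text \<open>The form in which the inequality of arithmetic and geometric means absorbs inner products
  that are controlled only through their squares; the factors \<open>a\<close> and \<open>b\<close> may vanish.\<close>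

lemma twice_le_add_of_square_le:
  fixes d a b :: real
  assumes "d\<^sup>2 \<le> a * b" "0 \<le> a" "0 \<le> b"
  shows "2 * \<bar>d\<bar> \<le> a + b"
proof -
  have "(2 * \<bar>d\<bar>)\<^sup>2 \<le> (a + b)\<^sup>2"
    using assms(1) zero_le_power2[of "a - b"] by (simp add: power2_sum power2_diff power_mult_distrib)
  then show ?thesis by (rule power2_le_imp_le) (use assms in auto)
qed

section \<open>The energy estimate\<close>

lemma norm_diff_square_le:
  fixes a b :: "'a::real_inner"
  shows "(norm (a - b))\<^sup>2 \<le> 2 * (norm a)\<^sup>2 + 2 * (norm b)\<^sup>2"
  using zero_le_power2[of "norm (a + b)"]
  unfolding power2_norm_eq_inner by (simp add: inner_diff inner_add inner_commute)

lemma norm_diff_diff_square_le: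
  fixes a b c :: "'a::real_inner"
  shows "(norm (a - b - c))\<^sup>2 \<le> 3 * ((norm a)\<^sup>2 + (norm b)\<^sup>2 + (norm c)\<^sup>2)"
  using zero_le_power2[of "norm (a + b)"] zero_le_power2[of "norm (a + c)"] zero_le_power2[of "norm (b - c)"]
  unfolding power2_norm_eq_inner by (simp add: inner_diff inner_add inner_commute)

text \<open>Exact subgradient inclusions with perturbations \<open>dx\<close> and \<open>dy\<close>. The error bounds are
  stated in squared and dual form: tested against any \<open>v\<close>, the perturbation is at most
  \<open>sqrt (m k)\<close> times the length of the current step times the length of \<open>v\<close>, both measured by
  the proximal operator. Constants that compare norms are absorbed in \<open>m\<close>, which by its
  summability is eventually below any given threshold.\<close>

locale inexact_admm =
  fixes f :: "'x::euclidean_space \<Rightarrow> ereal" and g :: "'y::euclidean_space \<Rightarrow> ereal"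
    and A :: "'z::euclidean_space \<Rightarrow> 'x" and B :: "'z \<Rightarrow> 'y" and c :: 'z
    and \<Sigma>f Pf :: "'x \<Rightarrow> 'x" and \<Sigma>g Pg :: "'y \<Rightarrow> 'y" and \<sigma> \<tau> :: real
    and x :: "nat \<Rightarrow> 'x" and y :: "nat \<Rightarrow> 'y" and z :: "nat \<Rightarrow> 'z"
    and dx :: "nat \<Rightarrow> 'x" and dy :: "nat \<Rightarrow> 'y" and m :: "nat \<Rightarrow> real"
  assumes f: "closed_proper_convex f" and g: "closed_proper_convex g"
    and A: "linear A" and B: "linear B"
    and \<Sigma>f: "convexity_operator f \<Sigma>f" and \<Sigma>g: "convexity_operator g \<Sigma>g"
    and \<sigma>: "0 < \<sigma>" and \<tau>: "0 < \<tau>"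
    and Pf: "selfadj Pf" and Pg: "selfadj Pg"
    and Pf_psd: "psd (\<lambda>u. Pf u + (3/8) *\<^sub>R \<Sigma>f u)"
    and Pg_psd: "psd (\<lambda>v. Pg v + (3/8) *\<^sub>R \<Sigma>g v)"
    and Tf: "posdef (prox_op Pf \<Sigma>f \<sigma> A)" and Tg: "posdef (prox_op Pg \<Sigma>g \<sigma> B)"
    and z_step: "\<And>k. z (Suc k) = z k + (\<tau> * \<sigma>) *\<^sub>R residual A B c (x (Suc k)) (y (Suc k))"
    and x_step: "\<And>k. dx k - A (z k + \<sigma> *\<^sub>R residual A B c (x (Suc k)) (y k)) - Pf (x (Suc k) - x k)
        \<in> subdiff f (x (Suc k))"
    and y_step: "\<And>k. dy k - B (z k + \<sigma> *\<^sub>R residual A B c (x (Suc k)) (y (Suc k)))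
        - Pg (y (Suc k) - y k) \<in> subdiff g (y (Suc k))"
    and m: "summable m" "\<And>k. 0 \<le> m k"
    and dx: "\<And>k v. (dx k \<bullet> v)\<^sup>2 \<le> m k * sqnorm_op (prox_op Pf \<Sigma>f \<sigma> A) (x (Suc k) - x k)
        * sqnorm_op (prox_op Pf \<Sigma>f \<sigma> A) v"
    and dy: "\<And>k v. (dy k \<bullet> v)\<^sup>2 \<le> m k * sqnorm_op (prox_op Pg \<Sigma>g \<sigma> B) (y (Suc k) - y k)
        * sqnorm_op (prox_op Pg \<Sigma>g \<sigma> B) v"
begin

text \<open>The quantities of the energy balance: \<open>\<rho>\<close> measures infeasibility, and \<open>p\<close>, \<open>q\<close>
  and \<open>\<beta>\<close> measure the steps; \<open>q + \<beta>\<close> is the square of the step in \<open>y\<close> for the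
  positive definite proximal operator. The coefficient \<open>3/4\<close> in \<open>\<omega>\<close> is what the
  comparison of consecutive steps in \<open>y\<close> produces, twice the permitted indefiniteness
  \<open>3/8\<close>. The function \<open>\<Phi>\<close> is the squared distance to a reference point. The form in
  \<open>x\<close> is only semidefinite, as it lacks the term from \<open>A\<close>.\<close>

definition r :: "nat \<Rightarrow> 'z" where "r k = residual A B c (x k) (y k)"
definition \<Delta>x :: "nat \<Rightarrow> 'x" where "\<Delta>x k = x (Suc k) - x k"
definition \<Delta>y :: "nat \<Rightarrow> 'y" where "\<Delta>y k = y (Suc k) - y k"
definition \<rho> :: "nat \<Rightarrow> real" where "\<rho> k = \<sigma> * (norm (r k))\<^sup>2"
definition \<beta> :: "nat \<Rightarrow> real" where "\<beta> k = \<sigma> * (norm (adjoint B (\<Delta>y k)))\<^sup>2"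
definition p :: "nat \<Rightarrow> real" where "p k = sqnorm_op Pf (\<Delta>x k) + sqnorm_op \<Sigma>f (\<Delta>x k)"
definition q :: "nat \<Rightarrow> real" where "q k = sqnorm_op Pg (\<Delta>y k) + sqnorm_op \<Sigma>g (\<Delta>y k)"
definition \<omega> :: "nat \<Rightarrow> real" where
  "\<omega> k = sqnorm_op Pg (\<Delta>y k) + 3/4 * sqnorm_op \<Sigma>g (\<Delta>y k)"

definition \<Phi> :: "'x \<Rightarrow> 'y \<Rightarrow> 'z \<Rightarrow> nat \<Rightarrow> real" where
  "\<Phi> xs ys zs k = (norm (z k - zs))\<^sup>2 / (\<tau> * \<sigma>)
     + (sqnorm_op Pf (x k - xs) + sqnorm_op \<Sigma>f (x k - xs))
     + sqnorm_op (prox_op Pg \<Sigma>g \<sigma> B) (y k - ys)"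

lemma \<Sigma>f_psd: "psd \<Sigma>f" and \<Sigma>g_psd: "psd \<Sigma>g"
  using \<Sigma>f \<Sigma>g by (auto simp: convexity_operator_def)

lemma \<Sigma>_nonneg [simp]: "0 \<le> sqnorm_op \<Sigma>f u" "0 \<le> sqnorm_op \<Sigma>g v"
  using \<Sigma>f_psd \<Sigma>g_psd by (auto simp: psd_def sqnorm_op_def)

lemma P_lower:
  "0 \<le> sqnorm_op Pf u + 3/8 * sqnorm_op \<Sigma>f u" "0 \<le> sqnorm_op Pg v + 3/8 * sqnorm_op \<Sigma>g v"
  using Pf_psd Pg_psd by (simp_all add: psd_def sqnorm_op_def inner_add_right)

lemma P\<Sigma>_nonneg:
  "0 \<le> sqnorm_op Pf u + sqnorm_op \<Sigma>f u" "0 \<le> sqnorm_op Pg v + sqnorm_op \<Sigma>g v"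
  "0 \<le> sqnorm_op Pg v + 3/4 * sqnorm_op \<Sigma>g v"
  using P_lower(1)[of u] P_lower(2)[of v] \<Sigma>_nonneg(1)[of u] \<Sigma>_nonneg(2)[of v] by linarith+

lemma T_split:
  "sqnorm_op (prox_op Pf \<Sigma>f \<sigma> A) u
     = sqnorm_op Pf u + sqnorm_op \<Sigma>f u + \<sigma> * (norm (adjoint A u))\<^sup>2"
  "sqnorm_op (prox_op Pg \<Sigma>g \<sigma> B) v
     = sqnorm_op Pg v + sqnorm_op \<Sigma>g v + \<sigma> * (norm (adjoint B v))\<^sup>2"
  by (simp_all add: sqnorm_op_def prox_op_def inner_add_right power2_norm_eq_inner
      inner_adjoint[OF A] inner_adjoint[OF B] inner_commute[of u] inner_commute[of v] inner_add_left)

lemma T_nonneg [simp]: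
  "0 \<le> sqnorm_op (prox_op Pf \<Sigma>f \<sigma> A) u" "0 \<le> sqnorm_op (prox_op Pg \<Sigma>g \<sigma> B) v"
  using Tf Tg by (auto intro: posdef_nonneg)

lemma nonneg [simp]: "0 \<le> \<rho> k" "0 \<le> \<beta> k" "0 \<le> p k" "0 \<le> q k" "0 \<le> \<omega> k" "0 \<le> \<Phi> xs ys zs k"
  using \<sigma> \<tau> P\<Sigma>_nonneg by (auto simp: \<rho>_def \<beta>_def p_def q_def \<omega>_def \<Phi>_def intro!: add_nonneg_nonneg)

lemma Tg_\<Delta>y: "sqnorm_op (prox_op Pg \<Sigma>g \<sigma> B) (\<Delta>y k) = q k + \<beta> k"
  by (simp add: T_split q_def \<beta>_def)

lemma linear_adjoints: "linear (adjoint A)" "linear (adjoint B)"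
  using A B by (auto intro: adjoint_linear)

lemma residual_kkt:
  assumes "kkt_point f g A B c xs ys zs"
  shows "r k = adjoint A (x k - xs) + adjoint B (y k - ys)"
proof -
  have "adjoint A xs + adjoint B ys = c" using assms by (simp add: kkt_point_def residual_def)
  then show ?thesis
    by (simp add: r_def residual_def linear_diff[OF linear_adjoints(1)]
        linear_diff[OF linear_adjoints(2)] algebra_simps)
qed

lemma residual_half: "residual A B c (x (Suc k)) (y k) = r (Suc k) - adjoint B (\<Delta>y k)"
  by (simp add: r_def residual_def \<Delta>y_def linear_diff[OF linear_adjoints(2)])

text \<open>The algebra of the multiplier step. Here \<open>R\<close> is the new residual, \<open>R - h\<close> and \<open>h\<close> are
  the contributions of the errors in \<open>x\<close> and in \<open>y\<close>, \<open>b\<close> comes from the step in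
  \<open>y\<close>, and \<open>w\<close> is the old multiplier error.\<close>

lemma multiplier_identity:
  fixes h R b w :: 'z
  shows "2 * ((w + \<sigma> *\<^sub>R (R - b)) \<bullet> (R - h)) + 2 * ((w + \<sigma> *\<^sub>R R) \<bullet> h)
    = (norm (w + (\<tau> * \<sigma>) *\<^sub>R R))\<^sup>2 / (\<tau> * \<sigma>) - (norm w)\<^sup>2 / (\<tau> * \<sigma>)
      + (2 - \<tau>) * (\<sigma> * (norm R)\<^sup>2) - 2 * \<sigma> * (b \<bullet> R)
      + \<sigma> * (norm h)\<^sup>2 - \<sigma> * (norm (h - b))\<^sup>2 + \<sigma> * (norm b)\<^sup>2"
proof -
  have "(norm (w + (\<tau> * \<sigma>) *\<^sub>R R))\<^sup>2 / (\<tau> * \<sigma>)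
      = (norm w)\<^sup>2 / (\<tau> * \<sigma>) + 2 * (w \<bullet> R) + \<tau> * (\<sigma> * (norm R)\<^sup>2)"
    using \<sigma> \<tau> unfolding power2_norm_eq_inner
    by (simp add: inner_add inner_commute field_simps)
  moreover have "\<sigma> * (norm (h - b))\<^sup>2 = \<sigma> * (norm h)\<^sup>2 - 2 * \<sigma> * (b \<bullet> h) + \<sigma> * (norm b)\<^sup>2"
    unfolding power2_norm_eq_inner by (simp add: inner_diff inner_commute algebra_simps)
  moreover have "(norm R)\<^sup>2 = R \<bullet> R" by (rule power2_norm_eq_inner)
  ultimately show ?thesis
    by (simp add: inner_add inner_diff inner_commute algebra_simps)
qed

text \<open>Monotonicity of both subdifferentials, between the new iterate and the reference point, adds up
  to a decrease of \<open>\<Phi>\<close>. Doubled, it yields two copies of the form of \<open>\<Sigma>f\<close> at the new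
  error. One becomes part of the new \<open>\<Phi>\<close>; a copy at the old error, added to both sides, completes
  the old \<open>\<Phi>\<close>. The two copies that are left on the side of the decrease, at the new
  and at the old error, dominate half the form of \<open>\<Sigma>f\<close> at the step. Since
  \<open>Pf + (3/8) \<Sigma>f\<close> is semidefinite, \<open>Pf + (1/2) \<Sigma>f\<close> dominates \<open>(1/5) (Pf + \<Sigma>f)\<close>,
  which is the origin of the factor \<open>1/5\<close>. The same happens in \<open>y\<close>. What remains is the
  bracket containing the cross term, whose sign is not determined.\<close>

lemma main_estimate:
  assumes kkt: "kkt_point f g A B c xs ys zs"
  shows "\<Phi> xs ys zs (Suc k) + p k / 5 + q k / 5
      + (\<beta> k + (2 - \<tau>) * \<rho> (Suc k) - 2 * \<sigma> * (adjoint B (\<Delta>y k) \<bullet> r (Suc k)))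
    \<le> \<Phi> xs ys zs k + 2 * (dx k \<bullet> (x (Suc k) - xs)) + 2 * (dy k \<bullet> (y (Suc k) - ys))"
proof -
  define a b w h where "a = x (Suc k) - xs" and "b = y (Suc k) - ys"
    and "w = z k - zs" and "h = adjoint B b"
  have hx: "adjoint A a = r (Suc k) - h"
    using residual_kkt[OF kkt, of "Suc k"] by (simp add: a_def b_def h_def)
  have ho: "adjoint B (y k - ys) = h - adjoint B (\<Delta>y k)"
    by (simp add: h_def b_def \<Delta>y_def flip: linear_diff[OF linear_adjoints(2)])
  have "sqnorm_op \<Sigma>f a \<le> (dx k - A (z k + \<sigma> *\<^sub>R (r (Suc k) - adjoint B (\<Delta>y k))) - Pf (\<Delta>x k) - - A zs) \<bullet> a"
    unfolding a_def using subdiff_monotone[OF \<Sigma>f x_step[of k], of "- A zs" xs] kkt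
    by (simp add: kkt_point_def residual_half \<Delta>x_def)
  also have "\<dots> = dx k \<bullet> a - A (w + \<sigma> *\<^sub>R (r (Suc k) - adjoint B (\<Delta>y k))) \<bullet> a - Pf (\<Delta>x k) \<bullet> a"
    by (simp add: w_def linear_add[OF A] linear_diff[OF A] inner_diff_left inner_add_left)
  finally have X: "sqnorm_op \<Sigma>f a \<le> dx k \<bullet> a
      - (w + \<sigma> *\<^sub>R (r (Suc k) - adjoint B (\<Delta>y k))) \<bullet> (r (Suc k) - h) - Pf (\<Delta>x k) \<bullet> a"
    by (simp only: inner_adjoint[OF A] hx)
  have "sqnorm_op \<Sigma>g b \<le> (dy k - B (z k + \<sigma> *\<^sub>R r (Suc k)) - Pg (\<Delta>y k) - - B zs) \<bullet> b"
    unfolding b_def using subdiff_monotone[OF \<Sigma>g y_step[of k], of "- B zs" ys] kkt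
    by (simp add: kkt_point_def r_def \<Delta>y_def)
  also have "\<dots> = dy k \<bullet> b - B (w + \<sigma> *\<^sub>R r (Suc k)) \<bullet> b - Pg (\<Delta>y k) \<bullet> b"
    by (simp add: w_def linear_add[OF B] linear_diff[OF B] inner_diff_left inner_add_left)
  finally have Y: "sqnorm_op \<Sigma>g b \<le> dy k \<bullet> b - (w + \<sigma> *\<^sub>R r (Suc k)) \<bullet> h - Pg (\<Delta>y k) \<bullet> b"
    by (simp only: inner_adjoint[OF B] h_def)
  have px: "2 * (Pf (\<Delta>x k) \<bullet> a) = sqnorm_op Pf a - sqnorm_op Pf (x k - xs) + sqnorm_op Pf (\<Delta>x k)"
    unfolding a_def \<Delta>x_def by (rule sqnorm_op_three_point[OF Pf])
  have py: "2 * (Pg (\<Delta>y k) \<bullet> b) = sqnorm_op Pg b - sqnorm_op Pg (y k - ys) + sqnorm_op Pg (\<Delta>y k)"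
    unfolding b_def \<Delta>y_def by (rule sqnorm_op_three_point[OF Pg])
  have sx: "sqnorm_op \<Sigma>f (\<Delta>x k) \<le> 2 * sqnorm_op \<Sigma>f a + 2 * sqnorm_op \<Sigma>f (x k - xs)"
    using psd_diff_le[OF \<Sigma>f_psd, of a "x k - xs"] by (simp add: a_def \<Delta>x_def)
  have sy: "sqnorm_op \<Sigma>g (\<Delta>y k) \<le> 2 * sqnorm_op \<Sigma>g b + 2 * sqnorm_op \<Sigma>g (y k - ys)"
    using psd_diff_le[OF \<Sigma>g_psd, of b "y k - ys"] by (simp add: b_def \<Delta>y_def)
  have zs: "z (Suc k) - zs = w + (\<tau> * \<sigma>) *\<^sub>R r (Suc k)"
    by (simp add: w_def r_def z_step)
  have \<Phi>1: "\<Phi> xs ys zs (Suc k) = (norm (w + (\<tau> * \<sigma>) *\<^sub>R r (Suc k)))\<^sup>2 / (\<tau> * \<sigma>)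
     + sqnorm_op Pf a + sqnorm_op \<Sigma>f a + sqnorm_op Pg b + sqnorm_op \<Sigma>g b + \<sigma> * (norm h)\<^sup>2"
    unfolding \<Phi>_def zs T_split by (simp add: a_def b_def h_def)
  have \<Phi>0: "\<Phi> xs ys zs k = (norm w)\<^sup>2 / (\<tau> * \<sigma>) + sqnorm_op Pf (x k - xs) + sqnorm_op \<Sigma>f (x k - xs)
     + sqnorm_op Pg (y k - ys) + sqnorm_op \<Sigma>g (y k - ys) + \<sigma> * (norm (h - adjoint B (\<Delta>y k)))\<^sup>2"
    unfolding \<Phi>_def T_split ho by (simp add: w_def)
  have "2 * sqnorm_op \<Sigma>f a + 2 * sqnorm_op \<Sigma>g b \<le> 2 * (dx k \<bullet> a) + 2 * (dy k \<bullet> b)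
      - (2 * ((w + \<sigma> *\<^sub>R (r (Suc k) - adjoint B (\<Delta>y k))) \<bullet> (r (Suc k) - h)) + 2 * ((w + \<sigma> *\<^sub>R r (Suc k)) \<bullet> h))
      - (2 * (Pf (\<Delta>x k) \<bullet> a) + 2 * (Pg (\<Delta>y k) \<bullet> b))"
    using X Y by linarith
  note main = this[unfolded multiplier_identity px py]
  show ?thesis
    using main sx sy P_lower(1)[of "\<Delta>x k"] P_lower(2)[of "\<Delta>y k"] \<Sigma>_nonneg(1)[of "\<Delta>x k"] \<Sigma>_nonneg(2)[of "\<Delta>y k"]
    unfolding \<Phi>1 \<Phi>0 p_def q_def \<beta>_def \<rho>_def a_def[symmetric] b_def[symmetric] by argo
qed

end

section \<open>Bounds for the cross term\<close>

context inexact_admm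
begin

text \<open>Monotonicity of the subdifferential of \<open>g\<close> between two consecutive iterates trades the cross term
  with the new residual for one with the old residual, weighted by \<open>1 - \<tau>\<close>. The inner product
  of consecutive steps under the indefinite \<open>Pg\<close> is split as
  \<open>(Pg + (3/8) \<Sigma>g) - (3/8) \<Sigma>g\<close> and each part is estimated by half the sum of squares, so that
  twice the inner product is at most the sum of \<open>\<omega>\<close> at the two steps. This leaves a telescoping
  difference of \<open>\<omega>\<close>.\<close>

lemma coupling:
  assumes \<epsilon>: "0 < \<epsilon>" and small: "m k \<le> \<epsilon>\<^sup>2" "m (Suc k) \<le> \<epsilon>\<^sup>2"
  shows "\<omega> (Suc k) - \<omega> k - \<epsilon> * (q k + \<beta> k + 3 * (q (Suc k) + \<beta> (Suc k)))
    \<le> 2 * \<sigma> * (1 - \<tau>) * (adjoint B (\<Delta>y (Suc k)) \<bullet> r (Suc k))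
      - 2 * \<sigma> * (adjoint B (\<Delta>y (Suc k)) \<bullet> r (Suc (Suc k)))"
proof -
  let ?k = "Suc k"
  let ?d = "\<Delta>y ?k" and ?o = "\<Delta>y k"
  have "sqnorm_op \<Sigma>g ?d \<le> ((dy ?k - B (z ?k + \<sigma> *\<^sub>R r (Suc ?k)) - Pg ?d)
      - (dy k - B (z k + \<sigma> *\<^sub>R r ?k) - Pg ?o)) \<bullet> ?d"
    using subdiff_monotone[OF \<Sigma>g y_step[of ?k] y_step[of k]] by (simp add: r_def \<Delta>y_def)
  also have "\<dots> = dy ?k \<bullet> ?d - dy k \<bullet> ?d - B (\<sigma> *\<^sub>R (r (Suc ?k) - (1 - \<tau>) *\<^sub>R r ?k)) \<bullet> ?d
      - Pg ?d \<bullet> ?d + Pg ?o \<bullet> ?d"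
  proof -
    have "B (\<sigma> *\<^sub>R (r (Suc ?k) - (1 - \<tau>) *\<^sub>R r ?k)) = B (z ?k + \<sigma> *\<^sub>R r (Suc ?k)) - B (z k + \<sigma> *\<^sub>R r ?k)"
      unfolding linear_diff[OF B, symmetric]
      by (rule arg_cong[of _ _ B]) (simp add: z_step r_def algebra_simps)
    then show ?thesis by (simp add: inner_diff_left inner_add_left)
  qed
  also have "B (\<sigma> *\<^sub>R (r (Suc ?k) - (1 - \<tau>) *\<^sub>R r ?k)) \<bullet> ?d
      = \<sigma> * (adjoint B ?d \<bullet> r (Suc ?k)) - \<sigma> * (1 - \<tau>) * (adjoint B ?d \<bullet> r ?k)"
    unfolding inner_adjoint[OF B] by (simp add: inner_diff_left inner_commute algebra_simps)
  also have "Pg ?d \<bullet> ?d = sqnorm_op Pg ?d" by (simp add: sqnorm_op_def inner_commute)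
  finally have mono: "sqnorm_op \<Sigma>g ?d \<le> dy ?k \<bullet> ?d - dy k \<bullet> ?d
      - (\<sigma> * (adjoint B ?d \<bullet> r (Suc ?k)) - \<sigma> * (1 - \<tau>) * (adjoint B ?d \<bullet> r ?k))
      - sqnorm_op Pg ?d + Pg ?o \<bullet> ?d" .
  have "2 * (Pg ?o \<bullet> ?d) + 3/4 * (\<Sigma>g ?o \<bullet> ?d)
      \<le> sqnorm_op Pg ?o + 3/8 * sqnorm_op \<Sigma>g ?o + sqnorm_op Pg ?d + 3/8 * sqnorm_op \<Sigma>g ?d"
    using psd_inner_le[OF Pg_psd, of ?o ?d] by (simp add: sqnorm_op_def inner_add_left inner_add_right)
  moreover have "0 \<le> sqnorm_op \<Sigma>g ?o + sqnorm_op \<Sigma>g ?d + 2 * (\<Sigma>g ?o \<bullet> ?d)"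
    using \<Sigma>_nonneg(2)[of "?o + ?d"] \<Sigma>g_psd
    by (simp add: sqnorm_op_add psd_def del: \<Sigma>_nonneg)
  ultimately have PP: "2 * (Pg ?o \<bullet> ?d) \<le> \<omega> k + \<omega> ?k" by (simp add: \<omega>_def)
  have "(dy ?k \<bullet> ?d)\<^sup>2 \<le> m ?k * (q ?k + \<beta> ?k) * (q ?k + \<beta> ?k)"
    using dy[of ?k ?d] by (simp add: Tg_\<Delta>y[unfolded \<Delta>y_def] \<Delta>y_def)
  also have "\<dots> \<le> \<epsilon>\<^sup>2 * (q ?k + \<beta> ?k) * (q ?k + \<beta> ?k)"
    by (intro mult_right_mono small) auto
  finally have d1: "2 * \<bar>dy ?k \<bullet> ?d\<bar> \<le> \<epsilon> * (q ?k + \<beta> ?k) + \<epsilon> * (q ?k + \<beta> ?k)"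
    using \<epsilon> by (intro twice_le_add_of_square_le) (auto simp: power2_eq_square algebra_simps)
  have "(dy k \<bullet> ?d)\<^sup>2 \<le> m k * (q k + \<beta> k) * (q ?k + \<beta> ?k)"
    using dy[of k ?d] unfolding Tg_\<Delta>y by (simp add: Tg_\<Delta>y[unfolded \<Delta>y_def] \<Delta>y_def)
  also have "\<dots> \<le> \<epsilon>\<^sup>2 * (q k + \<beta> k) * (q ?k + \<beta> ?k)"
    by (intro mult_right_mono small) auto
  finally have d2: "2 * \<bar>dy k \<bullet> ?d\<bar> \<le> \<epsilon> * (q k + \<beta> k) + \<epsilon> * (q ?k + \<beta> ?k)"
    using \<epsilon> by (intro twice_le_add_of_square_le) (auto simp: power2_eq_square algebra_simps)
  have "2 * (dy ?k \<bullet> ?d - dy k \<bullet> ?d) \<le> \<epsilon> * (q k + \<beta> k + 3 * (q ?k + \<beta> ?k))"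
    using d1 d2 by (simp add: algebra_simps)
  moreover have "\<omega> ?k \<le> 2 * (sqnorm_op Pg ?d + sqnorm_op \<Sigma>g ?d) - \<omega> ?k"
    using \<Sigma>_nonneg(2)[of ?d] by (simp add: \<omega>_def)
  ultimately show ?thesis using mono PP by (simp add: mult.assoc)
qed

text \<open>What the convergence proof needs of the cross term: up to a summable error, up to telescoping
  multiples of \<open>\<rho>\<close> and \<open>\<omega>\<close>, and up to arbitrarily small multiples of the steps, the bracket in
  the energy estimate controls the residual and the step in \<open>y\<close>. The index is shifted by one because
  \<open>\<omega> k\<close> refers to the preceding step.\<close>

definition cross_bound :: "real \<Rightarrow> real \<Rightarrow> real \<Rightarrow> (nat \<Rightarrow> real) \<Rightarrow> bool" where
  "cross_bound e \<kappa> \<iota> s \<longleftrightarrow> 0 < e \<and> 0 \<le> \<kappa> \<and> 0 \<le> \<iota> \<and> summable s \<and> (\<forall>k. 0 \<le> s k) \<and>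
     (\<forall>\<epsilon>>0. eventually (\<lambda>k.
        e * (\<rho> (Suc (Suc k)) + \<beta> (Suc k)) + \<kappa> * (\<rho> (Suc (Suc k)) - \<rho> (Suc k))
          + \<iota> * (\<omega> (Suc k) - \<omega> k) - \<epsilon> * (q k + \<beta> k + 3 * (q (Suc k) + \<beta> (Suc k)))
        \<le> \<beta> (Suc k) + (2 - \<tau>) * \<rho> (Suc (Suc k))
          - 2 * \<sigma> * (adjoint B (\<Delta>y (Suc k)) \<bullet> r (Suc (Suc k))) + s k) sequentially)"

lemma young:
  assumes "0 < \<theta>"
  shows "\<bar>2 * \<sigma> * (adjoint B (\<Delta>y k) \<bullet> r j)\<bar> \<le> \<theta> * \<rho> j + \<beta> k / \<theta>"
proof -
  have "(\<sigma> * (adjoint B (\<Delta>y k) \<bullet> r j))\<^sup>2 \<le> \<sigma>\<^sup>2 * ((norm (adjoint B (\<Delta>y k)))\<^sup>2 * (norm (r j))\<^sup>2)"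
    using Cauchy_Schwarz_ineq[of "adjoint B (\<Delta>y k)" "r j"]
    by (simp add: power_mult_distrib mult_left_mono power2_norm_eq_inner)
  also have "\<dots> = (\<theta> * \<rho> j) * (\<beta> k / \<theta>)"
    using assms by (simp add: \<rho>_def \<beta>_def power2_eq_square)
  finally have "2 * \<bar>\<sigma> * (adjoint B (\<Delta>y k) \<bullet> r j)\<bar> \<le> \<theta> * \<rho> j + \<beta> k / \<theta>"
    using assms by (intro twice_le_add_of_square_le) auto
  then show ?thesis by (simp add: abs_mult mult.assoc)
qed

text \<open>After the exchange of residuals the cross term has weight \<open>1 - \<tau>\<close>, and Young's inequality with
  parameter \<open>\<theta>\<close> bounds it by \<open>cr\<close> times the old residual and \<open>cb\<close> times the step. It is
  absorbed if \<open>cr < 2 - \<tau>\<close> and \<open>cb < 1\<close>. A suitable \<open>\<theta>\<close> exists exactly for \<open>\<tau>\<close> below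
  the golden ratio.\<close>

lemma cross_bound_small_step:
  assumes "\<tau> \<le> 8/5"
  shows "\<exists>e \<kappa> \<iota> s. cross_bound e \<kappa> \<iota> s"
proof -
  (* For \<tau> = 8/5 the admissible values of \<theta> are those strictly between 3/5 and 2/3. *)
  define \<theta> :: real where "\<theta> = (if \<tau> \<le> 1 then 1 else 5/8)"
  define cr where "cr = \<bar>1 - \<tau>\<bar> * \<theta>"
  define cb where "cb = \<bar>1 - \<tau>\<bar> / \<theta>"
  define e where "e = min (2 - \<tau> - cr) (1 - cb)"
  have \<theta>: "0 < \<theta>" by (simp add: \<theta>_def)
  have e: "0 < e" "0 \<le> cr"
    using assms \<tau> by (auto simp: e_def cr_def cb_def \<theta>_def abs_if field_simps)
  have "cross_bound e cr 1 (\<lambda>_. 0)"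
    unfolding cross_bound_def
  proof (intro conjI allI impI e)
    fix \<epsilon> :: real assume \<epsilon>: "0 < \<epsilon>"
    have "eventually (\<lambda>k. m k < \<epsilon>\<^sup>2) sequentially"
      using summable_LIMSEQ_zero[OF m(1)] by (rule order_tendstoD) (use \<epsilon> in simp)
    moreover from this have "eventually (\<lambda>k. m (Suc k) < \<epsilon>\<^sup>2) sequentially"
      using eventually_sequentially_Suc[of "\<lambda>k. m k < \<epsilon>\<^sup>2"] by simp
    ultimately show "eventually (\<lambda>k. e * (\<rho> (Suc (Suc k)) + \<beta> (Suc k))
          + cr * (\<rho> (Suc (Suc k)) - \<rho> (Suc k))
          + 1 * (\<omega> (Suc k) - \<omega> k) - \<epsilon> * (q k + \<beta> k + 3 * (q (Suc k) + \<beta> (Suc k)))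
        \<le> \<beta> (Suc k) + (2 - \<tau>) * \<rho> (Suc (Suc k))
          - 2 * \<sigma> * (adjoint B (\<Delta>y (Suc k)) \<bullet> r (Suc (Suc k))) + 0) sequentially"
    proof eventually_elim
      case (elim k)
      have "\<bar>2 * \<sigma> * (1 - \<tau>) * (adjoint B (\<Delta>y (Suc k)) \<bullet> r (Suc k))\<bar>
          = \<bar>1 - \<tau>\<bar> * \<bar>2 * \<sigma> * (adjoint B (\<Delta>y (Suc k)) \<bullet> r (Suc k))\<bar>"
        by (simp add: abs_mult)
      also have "\<dots> \<le> \<bar>1 - \<tau>\<bar> * (\<theta> * \<rho> (Suc k) + \<beta> (Suc k) / \<theta>)"
        by (intro mult_left_mono young \<theta>) simp
      also have "\<dots> = cr * \<rho> (Suc k) + cb * \<beta> (Suc k)"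
        by (simp add: cr_def cb_def algebra_simps)
      finally have y: "2 * \<sigma> * (1 - \<tau>) * (adjoint B (\<Delta>y (Suc k)) \<bullet> r (Suc k))
          \<le> cr * \<rho> (Suc k) + cb * \<beta> (Suc k)" by linarith
      have "e * \<rho> (Suc (Suc k)) \<le> (2 - \<tau> - cr) * \<rho> (Suc (Suc k))"
        "e * \<beta> (Suc k) \<le> (1 - cb) * \<beta> (Suc k)"
        by (auto simp: e_def intro!: mult_right_mono)
      then show ?case
        using coupling[OF \<epsilon>, of k] elim y by (simp add: algebra_simps)
    qed
  qed auto
  then show ?thesis by blast
qed

text \<open>If the residuals, or the steps in \<open>y\<close>, are known to be square summable, then Young's inequality
  puts the cross term on the summable side at the expense of a fraction of the other quantity.\<close>

lemma cross_bound_summable_residual: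
  assumes "\<tau> < 2" "summable \<rho>"
  shows "\<exists>e \<kappa> \<iota> s. cross_bound e \<kappa> \<iota> s"
proof -
  define e where "e = min (2 - \<tau>) (1/2)"
  have e_le: "e \<le> 2 - \<tau>" "e \<le> 1/2" unfolding e_def by linarith+
  have "cross_bound e 0 0 (\<lambda>k. 2 * \<rho> (Suc (Suc k)))"
    unfolding cross_bound_def
  proof (intro conjI allI impI always_eventually)
    show "0 < e" using assms by (simp add: e_def)
    show "summable (\<lambda>k. 2 * \<rho> (Suc (Suc k)))"
      using summable_ignore_initial_segment[OF assms(2), of 2] by (intro summable_mult) simp
    fix \<epsilon> :: real and k assume \<epsilon>: "0 < \<epsilon>"
    have "0 \<le> \<epsilon> * (q k + \<beta> k + 3 * (q (Suc k) + \<beta> (Suc k)))"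
      using \<epsilon> by (intro mult_nonneg_nonneg add_nonneg_nonneg) auto
    moreover have "e * \<rho> (Suc (Suc k)) \<le> (2 - \<tau>) * \<rho> (Suc (Suc k))"
      "e * \<beta> (Suc k) \<le> (1/2) * \<beta> (Suc k)"
      using mult_right_mono[OF e_le(1), of "\<rho> (Suc (Suc k))"]
        mult_right_mono[OF e_le(2), of "\<beta> (Suc k)"] by simp_all
    ultimately show "e * (\<rho> (Suc (Suc k)) + \<beta> (Suc k)) + 0 * (\<rho> (Suc (Suc k)) - \<rho> (Suc k))
          + 0 * (\<omega> (Suc k) - \<omega> k) - \<epsilon> * (q k + \<beta> k + 3 * (q (Suc k) + \<beta> (Suc k)))
        \<le> \<beta> (Suc k) + (2 - \<tau>) * \<rho> (Suc (Suc k))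
          - 2 * \<sigma> * (adjoint B (\<Delta>y (Suc k)) \<bullet> r (Suc (Suc k))) + 2 * \<rho> (Suc (Suc k))"
      using young[of 2 "Suc k" "Suc (Suc k)"] by (simp add: distrib_left)
  qed auto
  then show ?thesis by blast
qed

lemma cross_bound_summable_displacement:
  assumes "\<tau> < 2" "summable (\<lambda>k. q k + \<beta> k)"
  shows "\<exists>e \<kappa> \<iota> s. cross_bound e \<kappa> \<iota> s"
proof -
  define \<theta> where "\<theta> = (2 - \<tau>) / 2"
  define e where "e = min \<theta> 1"
  have \<theta>: "0 < \<theta>" "2 - \<tau> = 2 * \<theta>" using assms(1) by (auto simp: \<theta>_def)
  have "summable \<beta>"
    by (rule summable_comparison_test[OF _ assms(2)]) auto
  have "cross_bound e 0 0 (\<lambda>k. \<beta> (Suc k) / \<theta>)"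
    unfolding cross_bound_def
  proof (intro conjI allI impI always_eventually)
    show "0 < e" using \<theta> by (simp add: e_def)
    show "summable (\<lambda>k. \<beta> (Suc k) / \<theta>)"
      using \<open>summable \<beta>\<close> by (intro summable_divide) (simp add: summable_Suc_iff)
    show "0 \<le> \<beta> (Suc k) / \<theta>" for k using \<theta> by simp
    fix \<epsilon> :: real and k assume \<epsilon>: "0 < \<epsilon>"
    have "0 \<le> \<epsilon> * (q k + \<beta> k + 3 * (q (Suc k) + \<beta> (Suc k)))"
      using \<epsilon> by (intro mult_nonneg_nonneg add_nonneg_nonneg) auto
    moreover have "e * \<rho> (Suc (Suc k)) \<le> \<theta> * \<rho> (Suc (Suc k))"
      "e * \<beta> (Suc k) \<le> 1 * \<beta> (Suc k)"
      unfolding e_def by (intro mult_right_mono; simp)+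
    ultimately show "e * (\<rho> (Suc (Suc k)) + \<beta> (Suc k)) + 0 * (\<rho> (Suc (Suc k)) - \<rho> (Suc k))
          + 0 * (\<omega> (Suc k) - \<omega> k) - \<epsilon> * (q k + \<beta> k + 3 * (q (Suc k) + \<beta> (Suc k)))
        \<le> \<beta> (Suc k) + (2 - \<tau>) * \<rho> (Suc (Suc k))
          - 2 * \<sigma> * (adjoint B (\<Delta>y (Suc k)) \<bullet> r (Suc (Suc k))) + \<beta> (Suc k) / \<theta>"
      using young[OF \<theta>(1), of "Suc k" "Suc (Suc k)"] unfolding \<theta>(2) by (simp add: distrib_left)
  qed auto
  then show ?thesis by blast
qed

end

section \<open>Convergence to a KKT point\<close>

locale coupled_admm = inexact_admm f g A B c \<Sigma>f Pf \<Sigma>g Pg \<sigma> \<tau> x y z dx dy m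
  for f :: "'x::euclidean_space \<Rightarrow> ereal" and g :: "'y::euclidean_space \<Rightarrow> ereal"
    and A :: "'z::euclidean_space \<Rightarrow> 'x" and B c \<Sigma>f Pf \<Sigma>g Pg \<sigma> \<tau> x y z dx dy m +
  fixes e \<kappa> \<iota> :: real and s :: "nat \<Rightarrow> real"
  assumes cross: "cross_bound e \<kappa> \<iota> s"
begin

lemma cross_consts: "0 < e" "0 \<le> \<kappa>" "0 \<le> \<iota>" "summable s" "0 \<le> s k"
  using cross by (auto simp: cross_bound_def)

text \<open>The error terms consume at most eight times \<open>\<epsilon>\<close> of each quantity in \<open>D\<close>, so that this choice
  leaves at least the same amount.\<close>

definition \<epsilon> :: real where "\<epsilon> = min (1/5) e / 16"

lemma \<epsilon>: "0 < \<epsilon>" "16 * \<epsilon> \<le> 1/5" "16 * \<epsilon> \<le> e"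
  using cross_consts(1) by (auto simp: \<epsilon>_def)

text \<open>The Lyapunov function. To the distance \<open>\<Phi>\<close> it adds what the cross term and the inexactness
  borrow from the preceding step; these terms tend to zero with the steps and do not depend on the
  reference point. The multiple of \<open>\<rho>\<close> also makes up for the semidefiniteness of \<open>\<Phi>\<close>
  in \<open>x\<close>.\<close>

definition \<Psi> :: "'x \<Rightarrow> 'y \<Rightarrow> 'z \<Rightarrow> nat \<Rightarrow> real" where
  "\<Psi> xs ys zs k = \<Phi> xs ys zs (Suc k) + \<iota> * \<omega> k + (\<kappa> + 3 * \<epsilon>) * \<rho> (Suc k) + \<epsilon> * (q k + \<beta> k)"

definition D :: "nat \<Rightarrow> real" where
  "D k = p (Suc k) + q (Suc k) + \<beta> (Suc k) + \<rho> (Suc (Suc k))"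

lemma \<Psi>_ge: "\<Phi> xs ys zs (Suc k) + 3 * \<epsilon> * \<rho> (Suc k) \<le> \<Psi> xs ys zs k"
proof -
  have "0 \<le> \<iota> * \<omega> k" "0 \<le> \<kappa> * \<rho> (Suc k)" "0 \<le> \<epsilon> * (q k + \<beta> k)"
    using \<epsilon> cross_consts by auto
  then show ?thesis by (simp add: \<Psi>_def distrib_right)
qed

lemma \<Psi>_nonneg: "0 \<le> \<Psi> xs ys zs k"
  using \<Psi>_ge[of xs ys zs k] \<epsilon> by (meson add_nonneg_nonneg mult_nonneg_nonneg nonneg less_imp_le order_trans zero_le_numeral)

lemma \<Psi>_dominates: "4 * \<Phi> xs ys zs (Suc k) + 2 * \<rho> (Suc k) \<le> (4 + 1 / \<epsilon>) * \<Psi> xs ys zs k"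
proof -
  have "0 \<le> 3 * \<epsilon> * \<rho> (Suc k)" "0 \<le> \<Phi> xs ys zs (Suc k)" using \<epsilon>(1) by auto
  then have "\<Phi> xs ys zs (Suc k) \<le> \<Psi> xs ys zs k" "2 * \<epsilon> * \<rho> (Suc k) \<le> \<Psi> xs ys zs k"
    using \<Psi>_ge[of xs ys zs k] \<epsilon>(1) by linarith+
  moreover from this(2) have "2 * \<rho> (Suc k) \<le> 1 / \<epsilon> * \<Psi> xs ys zs k"
    using \<epsilon>(1) by (simp add: field_simps)
  ultimately show ?thesis by (simp add: distrib_right)
qed

lemma D_nonneg: "0 \<le> D k"
  by (simp add: D_def)

text \<open>Infeasibility and the error in \<open>y\<close> determine the image of the error in \<open>x\<close> under the adjoint
  of \<open>A\<close>, which is exactly the part of the proximal operator that \<open>\<Phi>\<close> lacks.\<close>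

lemma error_bounds:
  assumes kkt: "kkt_point f g A B c xs ys zs"
  shows "sqnorm_op (prox_op Pf \<Sigma>f \<sigma> A) (x k - xs) \<le> 3 * \<Phi> xs ys zs k + 2 * \<rho> k"
    and "sqnorm_op (prox_op Pg \<Sigma>g \<sigma> B) (y k - ys) \<le> \<Phi> xs ys zs k"
    and "(norm (z k - zs))\<^sup>2 \<le> (\<tau> * \<sigma>) * \<Phi> xs ys zs k"
proof -
  have n: "0 \<le> (norm (z k - zs))\<^sup>2 / (\<tau> * \<sigma>)" using \<sigma> \<tau> by simp
  have y: "\<sigma> * (norm (adjoint B (y k - ys)))\<^sup>2 \<le> sqnorm_op (prox_op Pg \<Sigma>g \<sigma> B) (y k - ys)"
    using P\<Sigma>_nonneg(2)[of "y k - ys"] by (simp add: T_split)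
  have "adjoint A (x k - xs) = r k - adjoint B (y k - ys)"
    using residual_kkt[OF kkt, of k] by simp
  then have "\<sigma> * (norm (adjoint A (x k - xs)))\<^sup>2
      \<le> \<sigma> * (2 * (norm (r k))\<^sup>2 + 2 * (norm (adjoint B (y k - ys)))\<^sup>2)"
    using norm_diff_square_le \<sigma> by (simp add: mult_left_mono)
  then have "\<sigma> * (norm (adjoint A (x k - xs)))\<^sup>2 \<le> 2 * \<rho> k + 2 * (\<sigma> * (norm (adjoint B (y k - ys)))\<^sup>2)"
    by (simp add: \<rho>_def algebra_simps)
  then show "sqnorm_op (prox_op Pf \<Sigma>f \<sigma> A) (x k - xs) \<le> 3 * \<Phi> xs ys zs k + 2 * \<rho> k"
    using y n P\<Sigma>_nonneg(1)[of "x k - xs"] T_nonneg(2)[of "y k - ys"]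
    unfolding T_split(1) \<Phi>_def by argo
  show "sqnorm_op (prox_op Pg \<Sigma>g \<sigma> B) (y k - ys) \<le> \<Phi> xs ys zs k"
    using n P\<Sigma>_nonneg(1)[of "x k - xs"] by (simp add: \<Phi>_def)
  have "(norm (z k - zs))\<^sup>2 / (\<tau> * \<sigma>) \<le> \<Phi> xs ys zs k"
    using P\<Sigma>_nonneg(1)[of "x k - xs"] T_nonneg(2)[of "y k - ys"] unfolding \<Phi>_def by linarith
  then show "(norm (z k - zs))\<^sup>2 \<le> (\<tau> * \<sigma>) * \<Phi> xs ys zs k"
    using \<sigma> \<tau> by (simp add: divide_le_eq mult.commute)
qed

lemma Tf_\<Delta>x: "sqnorm_op (prox_op Pf \<Sigma>f \<sigma> A) (\<Delta>x k) \<le> p k + 3 * (\<rho> (Suc k) + \<rho> k + \<beta> k)"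
proof -
  have "adjoint A (\<Delta>x k) = r (Suc k) - r k - adjoint B (\<Delta>y k)"
    by (simp add: r_def residual_def \<Delta>x_def \<Delta>y_def linear_diff[OF linear_adjoints(1)]
        linear_diff[OF linear_adjoints(2)])
  then have "\<sigma> * (norm (adjoint A (\<Delta>x k)))\<^sup>2
      \<le> \<sigma> * (3 * ((norm (r (Suc k)))\<^sup>2 + (norm (r k))\<^sup>2 + (norm (adjoint B (\<Delta>y k)))\<^sup>2))"
    using norm_diff_diff_square_le \<sigma> by (simp add: mult_left_mono)
  then show ?thesis by (simp add: T_split p_def \<rho>_def \<beta>_def algebra_simps)
qed

text \<open>The products of the errors with the perturbations are split into \<open>\<epsilon>\<close> times the square of the step,
  which the decrease absorbs, and \<open>m k / \<epsilon>\<close> times the square of the new error, which is at most a small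
  multiple of the new value of \<open>\<Psi>\<close>.\<close>

lemma descent:
  assumes kkt: "kkt_point f g A B c xs ys zs"
  defines "C \<equiv> (4 + 1 / \<epsilon>) / \<epsilon>"
  shows "eventually (\<lambda>k. (1 - C * m (Suc k)) * \<Psi> xs ys zs (Suc k) + 8 * \<epsilon> * D k
    \<le> \<Psi> xs ys zs k + s k) sequentially"
proof -
  have "eventually (\<lambda>k. e * (\<rho> (Suc (Suc k)) + \<beta> (Suc k)) + \<kappa> * (\<rho> (Suc (Suc k)) - \<rho> (Suc k))
          + \<iota> * (\<omega> (Suc k) - \<omega> k) - \<epsilon> * (q k + \<beta> k + 3 * (q (Suc k) + \<beta> (Suc k)))
        \<le> \<beta> (Suc k) + (2 - \<tau>) * \<rho> (Suc (Suc k))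
          - 2 * \<sigma> * (adjoint B (\<Delta>y (Suc k)) \<bullet> r (Suc (Suc k))) + s k) sequentially"
    using cross \<epsilon>(1) by (simp add: cross_bound_def)
  then show ?thesis
  proof eventually_elim
    case (elim k)
    let ?k = "Suc k"
    let ?k' = "Suc (Suc k)"
    let ?\<Phi> = "\<Phi> xs ys zs"
    let ?Tf = "sqnorm_op (prox_op Pf \<Sigma>f \<sigma> A)" and ?Tg = "sqnorm_op (prox_op Pg \<Sigma>g \<sigma> B)"
    have "(dx ?k \<bullet> (x ?k' - xs))\<^sup>2 \<le> (\<epsilon> * ?Tf (\<Delta>x ?k)) * (m ?k / \<epsilon> * ?Tf (x ?k' - xs))"
      using dx[of ?k "x ?k' - xs"] \<epsilon>(1) by (simp add: \<Delta>x_def algebra_simps)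
    then have ex: "2 * \<bar>dx ?k \<bullet> (x ?k' - xs)\<bar> \<le> \<epsilon> * ?Tf (\<Delta>x ?k) + m ?k / \<epsilon> * ?Tf (x ?k' - xs)"
      using \<epsilon>(1) m(2) by (intro twice_le_add_of_square_le) auto
    have "(dy ?k \<bullet> (y ?k' - ys))\<^sup>2 \<le> (\<epsilon> * ?Tg (\<Delta>y ?k)) * (m ?k / \<epsilon> * ?Tg (y ?k' - ys))"
      using dy[of ?k "y ?k' - ys"] \<epsilon>(1) by (simp add: \<Delta>y_def algebra_simps)
    then have ey: "2 * \<bar>dy ?k \<bullet> (y ?k' - ys)\<bar> \<le> \<epsilon> * ?Tg (\<Delta>y ?k) + m ?k / \<epsilon> * ?Tg (y ?k' - ys)"
      using \<epsilon>(1) m(2) by (intro twice_le_add_of_square_le) auto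
    have tx: "\<epsilon> * ?Tf (\<Delta>x ?k) \<le> \<epsilon> * (p ?k + 3 * (\<rho> ?k' + \<rho> ?k + \<beta> ?k))"
      using \<epsilon>(1) by (intro mult_left_mono Tf_\<Delta>x) simp
    have "m ?k / \<epsilon> * ?Tf (x ?k' - xs) + m ?k / \<epsilon> * ?Tg (y ?k' - ys)
        \<le> m ?k / \<epsilon> * (4 * ?\<Phi> ?k' + 2 * \<rho> ?k')"
      unfolding distrib_left[symmetric]
      using error_bounds[OF kkt, of ?k'] m(2) \<epsilon>(1) by (intro mult_left_mono) auto
    also have "\<dots> \<le> m ?k / \<epsilon> * ((4 + 1 / \<epsilon>) * \<Psi> xs ys zs ?k)"
      using m(2) \<epsilon>(1) by (intro mult_left_mono \<Psi>_dominates) simp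
    also have "\<dots> = C * m ?k * \<Psi> xs ys zs ?k" by (simp add: C_def)
    finally have em: "m ?k / \<epsilon> * ?Tf (x ?k' - xs) + m ?k / \<epsilon> * ?Tg (y ?k' - ys)
        \<le> C * m ?k * \<Psi> xs ys zs ?k" .
    have slack: "0 \<le> (e - 16 * \<epsilon>) * \<rho> ?k'" "0 \<le> (e - 16 * \<epsilon>) * \<beta> ?k"
      "0 \<le> (1/5 - 16 * \<epsilon>) * p ?k" "0 \<le> (1/5 - 16 * \<epsilon>) * q ?k"
      "0 \<le> \<epsilon> * \<rho> ?k'" "0 \<le> \<epsilon> * \<beta> ?k" "0 \<le> \<epsilon> * p ?k" "0 \<le> \<epsilon> * q ?k"
      using \<epsilon> by (auto intro!: mult_nonneg_nonneg)
    have "2 * (dx ?k \<bullet> (x ?k' - xs)) + 2 * (dy ?k \<bullet> (y ?k' - ys))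
        \<le> \<epsilon> * (p ?k + 3 * (\<rho> ?k' + \<rho> ?k + \<beta> ?k)) + \<epsilon> * (q ?k + \<beta> ?k) + C * m ?k * \<Psi> xs ys zs ?k"
      using ex ey tx em unfolding Tg_\<Delta>y by linarith
    then have "?\<Phi> ?k' + p ?k / 5 + q ?k / 5 + e * (\<rho> ?k' + \<beta> ?k) + \<kappa> * (\<rho> ?k' - \<rho> ?k)
          + \<iota> * (\<omega> ?k - \<omega> k) - \<epsilon> * (q k + \<beta> k + 3 * (q ?k + \<beta> ?k)) - s k
        \<le> ?\<Phi> ?k + \<epsilon> * (p ?k + 3 * (\<rho> ?k' + \<rho> ?k + \<beta> ?k)) + \<epsilon> * (q ?k + \<beta> ?k)
          + C * m ?k * \<Psi> xs ys zs ?k"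
      using main_estimate[OF kkt, of ?k] elim by linarith
    moreover have "(1 - C * m ?k) * \<Psi> xs ys zs ?k = \<Psi> xs ys zs ?k - C * m ?k * \<Psi> xs ys zs ?k"
      by (simp add: algebra_simps)
    ultimately show ?case
      using slack unfolding \<Psi>_def[of xs ys zs k] \<Psi>_def[of _ _ _ "Suc k"] D_def
      by (simp add: algebra_simps)
  qed
qed

lemma energy_converges:
  assumes kkt: "kkt_point f g A B c xs ys zs"
  shows "convergent (\<Psi> xs ys zs)" "D \<longlonglongrightarrow> 0"
proof -
  define C where "C = (4 + 1 / \<epsilon>) / \<epsilon>"
  have C: "0 \<le> C" using \<epsilon>(1) by (simp add: C_def)
  have "summable (\<lambda>k. C * m (Suc k))"
    using m(1) by (intro summable_mult) (simp add: summable_Suc_iff)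
  then have *: "convergent (\<Psi> xs ys zs)" "(\<lambda>k. 8 * \<epsilon> * D k) \<longlonglongrightarrow> 0"
    using almost_descent[of "\<Psi> xs ys zs" "\<lambda>k. 8 * \<epsilon> * D k" s "\<lambda>k. C * m (Suc k)"]
      descent[OF kkt, folded C_def] \<Psi>_nonneg D_nonneg \<epsilon>(1) cross_consts C m(2) by auto
  show "convergent (\<Psi> xs ys zs)" by (rule *)
  show "D \<longlonglongrightarrow> 0" using tendsto_mult_left[OF *(2), of "1 / (8 * \<epsilon>)"] \<epsilon>(1) by simp
qed

text \<open>Shifted by one to match the index of \<open>\<Psi>\<close>.\<close>

definition w :: "nat \<Rightarrow> 'x \<times> 'y \<times> 'z" where "w k = (x (Suc k), y (Suc k), z (Suc k))"

lemma iterates_dist_le: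
  obtains K where "\<And>xs ys zs k. kkt_point f g A B c xs ys zs \<Longrightarrow>
    (norm (w k - (xs, ys, zs)))\<^sup>2 \<le> K * \<Psi> xs ys zs k"
proof -
  obtain CX where CX: "CX > 0" "\<forall>u. (norm u)\<^sup>2 \<le> CX * sqnorm_op (prox_op Pf \<Sigma>f \<sigma> A) u"
    using posdef_norm_bound[OF Tf] by blast
  obtain CY where CY: "CY > 0" "\<forall>u. (norm u)\<^sup>2 \<le> CY * sqnorm_op (prox_op Pg \<Sigma>g \<sigma> B) u"
    using posdef_norm_bound[OF Tg] by blast
  have "(norm (w k - (xs, ys, zs)))\<^sup>2
      \<le> ((CX + CY + \<tau> * \<sigma>) * (4 + 1 / \<epsilon>)) * \<Psi> xs ys zs k"
    if kkt: "kkt_point f g A B c xs ys zs" for xs ys zs k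
  proof -
    let ?G = "(4 + 1 / \<epsilon>) * \<Psi> xs ys zs k"
    note b = error_bounds[OF kkt, of "Suc k"]
    have "\<Phi> xs ys zs (Suc k) \<ge> 0" "\<rho> (Suc k) \<ge> 0" by auto
    then have G: "sqnorm_op (prox_op Pf \<Sigma>f \<sigma> A) (x (Suc k) - xs) \<le> ?G"
      "sqnorm_op (prox_op Pg \<Sigma>g \<sigma> B) (y (Suc k) - ys) \<le> ?G" "\<Phi> xs ys zs (Suc k) \<le> ?G"
      using b \<Psi>_dominates[of xs ys zs k] by linarith+
    have "(norm (w k - (xs, ys, zs)))\<^sup>2
        = (norm (x (Suc k) - xs))\<^sup>2 + (norm (y (Suc k) - ys))\<^sup>2 + (norm (z (Suc k) - zs))\<^sup>2"
      by (simp add: w_def norm_Pair)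
    also have "\<dots> \<le> CX * ?G + CY * ?G + (\<tau> * \<sigma>) * ?G"
    proof (intro add_mono)
      show "(norm (x (Suc k) - xs))\<^sup>2 \<le> CX * ?G"
        by (rule order_trans[OF CX(2)[rule_format] mult_left_mono[OF G(1)]]) (use CX(1) in simp)
      show "(norm (y (Suc k) - ys))\<^sup>2 \<le> CY * ?G"
        by (rule order_trans[OF CY(2)[rule_format] mult_left_mono[OF G(2)]]) (use CY(1) in simp)
      show "(norm (z (Suc k) - zs))\<^sup>2 \<le> (\<tau> * \<sigma>) * ?G"
        by (rule order_trans[OF b(3) mult_left_mono[OF G(3)]]) (use \<sigma> \<tau> in simp)
    qed
    finally show ?thesis by (simp add: algebra_simps)
  qed
  then show ?thesis using that by blast
qed

lemma increments_vanish:
  assumes "D \<longlonglongrightarrow> 0"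
  shows "p \<longlonglongrightarrow> 0" "q \<longlonglongrightarrow> 0" "\<beta> \<longlonglongrightarrow> 0" "\<rho> \<longlonglongrightarrow> 0" "r \<longlonglongrightarrow> 0"
    "\<Delta>x \<longlonglongrightarrow> 0" "\<Delta>y \<longlonglongrightarrow> 0" "dx \<longlonglongrightarrow> 0" "dy \<longlonglongrightarrow> 0"
proof -
  have le_D: "a \<longlonglongrightarrow> 0" if "\<And>k. 0 \<le> a (Suc k)" "\<And>k. a (Suc k) \<le> D k" for a :: "nat \<Rightarrow> real"
  proof -
    have "(\<lambda>k. a (Suc k)) \<longlonglongrightarrow> 0"
      using that by (rule tendsto_zero_squeeze[OF assms])
    then show ?thesis by (simp add: filterlim_sequentially_Suc)
  qed
  show p: "p \<longlonglongrightarrow> 0" and q: "q \<longlonglongrightarrow> 0" and \<beta>: "\<beta> \<longlonglongrightarrow> 0"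
    by (rule le_D; simp add: D_def)+
  have "(\<lambda>k. \<rho> (Suc k)) \<longlonglongrightarrow> 0" by (rule le_D; simp add: D_def)
  then show \<rho>: "\<rho> \<longlonglongrightarrow> 0" by (simp add: filterlim_sequentially_Suc)
  have "(\<lambda>k. 1 / \<sigma> * \<rho> k) \<longlonglongrightarrow> 1 / \<sigma> * 0" by (intro tendsto_intros \<rho>)
  then have "(\<lambda>k. (norm (r k))\<^sup>2) \<longlonglongrightarrow> 0" using \<sigma> by (simp add: \<rho>_def)
  then show r: "r \<longlonglongrightarrow> 0" by (rule tendsto_zero_of_square)
  have "(\<lambda>k. p k + 3 * (\<rho> (Suc k) + \<rho> k + \<beta> k)) \<longlonglongrightarrow> 0 + 3 * (0 + 0 + 0)"
    by (intro tendsto_intros p \<beta> \<rho> LIMSEQ_Suc)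
  then have lim: "(\<lambda>k. p k + 3 * (\<rho> (Suc k) + \<rho> k + \<beta> k)) \<longlonglongrightarrow> 0" by simp
  have tx: "(\<lambda>k. sqnorm_op (prox_op Pf \<Sigma>f \<sigma> A) (\<Delta>x k)) \<longlonglongrightarrow> 0"
    by (rule tendsto_zero_squeeze[OF lim]) (rule T_nonneg Tf_\<Delta>x)+
  then show "\<Delta>x \<longlonglongrightarrow> 0" by (rule posdef_tendsto_zero[OF Tf])
  have "(\<lambda>k. q k + \<beta> k) \<longlonglongrightarrow> 0 + 0" by (intro tendsto_intros q \<beta>)
  then have ty: "(\<lambda>k. sqnorm_op (prox_op Pg \<Sigma>g \<sigma> B) (\<Delta>y k)) \<longlonglongrightarrow> 0" by (simp add: Tg_\<Delta>y)
  then show "\<Delta>y \<longlonglongrightarrow> 0" by (rule posdef_tendsto_zero[OF Tg])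
  have m0: "m \<longlonglongrightarrow> 0" using m(1) by (rule summable_LIMSEQ_zero)
  show "dx \<longlonglongrightarrow> 0"
  proof (rule weakly_null_imp_null)
    show "(\<lambda>k. m k * sqnorm_op (prox_op Pf \<Sigma>f \<sigma> A) (\<Delta>x k)) \<longlonglongrightarrow> 0"
      using tendsto_mult[OF m0 tx] by simp
    fix v show "\<exists>C. \<forall>k. (dx k \<bullet> v)\<^sup>2 \<le> C * (m k * sqnorm_op (prox_op Pf \<Sigma>f \<sigma> A) (\<Delta>x k))"
      using dx[of _ v] by (intro exI[of _ "sqnorm_op (prox_op Pf \<Sigma>f \<sigma> A) v"]) (simp add: \<Delta>x_def mult.commute)
  qed
  show "dy \<longlonglongrightarrow> 0"
  proof (rule weakly_null_imp_null)
    show "(\<lambda>k. m k * sqnorm_op (prox_op Pg \<Sigma>g \<sigma> B) (\<Delta>y k)) \<longlonglongrightarrow> 0"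
      using tendsto_mult[OF m0 ty] by simp
    fix v show "\<exists>C. \<forall>k. (dy k \<bullet> v)\<^sup>2 \<le> C * (m k * sqnorm_op (prox_op Pg \<Sigma>g \<sigma> B) (\<Delta>y k))"
      using dy[of _ v] by (intro exI[of _ "sqnorm_op (prox_op Pg \<Sigma>g \<sigma> B) v"]) (simp add: \<Delta>y_def mult.commute)
  qed
qed

lemma cluster_point_kkt:
  assumes D: "D \<longlonglongrightarrow> 0" and \<phi>: "strict_mono \<phi>"
    and lim: "(\<lambda>n. x (Suc (\<phi> n))) \<longlonglongrightarrow> xb" "(\<lambda>n. y (Suc (\<phi> n))) \<longlonglongrightarrow> yb"
      "(\<lambda>n. z (Suc (\<phi> n))) \<longlonglongrightarrow> zb"
  shows "kkt_point f g A B c xb yb zb"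
proof -
  note sub = LIMSEQ_subseq_LIMSEQ[OF _ \<phi>, unfolded o_def]
  note van = increments_vanish[OF D]
  note van\<phi> = van(6-9)[THEN sub]
  note lin = A B linear_adjoints selfadj_linear[OF Pf] selfadj_linear[OF Pg]
  note cont = lin[THEN tendsto_linear]
  have r1: "(\<lambda>n. r (Suc (\<phi> n))) \<longlonglongrightarrow> 0" using LIMSEQ_Suc[OF van(5)] by (rule sub)
  have zeq: "z k = z (Suc k) - (\<tau> * \<sigma>) *\<^sub>R r (Suc k)" for k by (simp add: z_step r_def)
  have "(\<lambda>n. z (Suc (\<phi> n)) - (\<tau> * \<sigma>) *\<^sub>R r (Suc (\<phi> n))) \<longlonglongrightarrow> zb - (\<tau> * \<sigma>) *\<^sub>R 0"
    by (intro tendsto_intros lim r1)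
  then have z0: "(\<lambda>n. z (\<phi> n)) \<longlonglongrightarrow> zb" by (simp flip: zeq)
  have "(\<lambda>n. dx (\<phi> n) - A (z (\<phi> n) + \<sigma> *\<^sub>R (r (Suc (\<phi> n)) - adjoint B (\<Delta>y (\<phi> n)))) - Pf (\<Delta>x (\<phi> n)))
      \<longlonglongrightarrow> 0 - A (zb + \<sigma> *\<^sub>R (0 - adjoint B 0)) - Pf 0"
    by (intro tendsto_intros cont z0 r1 van\<phi>)
  moreover have "dx k - A (z k + \<sigma> *\<^sub>R (r (Suc k) - adjoint B (\<Delta>y k))) - Pf (\<Delta>x k)
      \<in> subdiff f (x (Suc k))" for k
    using x_step[of k] by (simp add: residual_half \<Delta>x_def)
  ultimately have "0 - A (zb + \<sigma> *\<^sub>R (0 - adjoint B 0)) - Pf 0 \<in> subdiff f xb"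
    by (intro subdiff_closed_graph[OF f _ _ lim(1)])
  then have "- A zb \<in> subdiff f xb" by (simp add: linear_0 lin)
  moreover have "- B zb \<in> subdiff g yb"
  proof -
    have "(\<lambda>n. dy (\<phi> n) - B (z (\<phi> n) + \<sigma> *\<^sub>R r (Suc (\<phi> n))) - Pg (\<Delta>y (\<phi> n)))
        \<longlonglongrightarrow> 0 - B (zb + \<sigma> *\<^sub>R 0) - Pg 0"
      by (intro tendsto_intros cont z0 r1 van\<phi>)
    moreover have "dy k - B (z k + \<sigma> *\<^sub>R r (Suc k)) - Pg (\<Delta>y k) \<in> subdiff g (y (Suc k))" for k
      using y_step[of k] by (simp add: r_def \<Delta>y_def)
    ultimately have "0 - B (zb + \<sigma> *\<^sub>R 0) - Pg 0 \<in> subdiff g yb"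
      by (intro subdiff_closed_graph[OF g _ _ lim(2)])
    then show ?thesis by (simp add: linear_0 lin)
  qed
  moreover have "residual A B c xb yb = 0"
  proof -
    have "(\<lambda>n. r (Suc (\<phi> n))) \<longlonglongrightarrow> residual A B c xb yb"
      unfolding r_def residual_def by (intro tendsto_intros cont lim)
    then show ?thesis using r1 LIMSEQ_unique by blast
  qed
  ultimately show ?thesis by (simp add: kkt_point_def)
qed

text \<open>Opial's argument. A reference KKT point makes \<open>\<Psi>\<close> bounded, hence the iterates have a cluster
  point, which is a KKT point because the steps vanish. With the cluster point as the new reference
  \<open>\<Psi>\<close> still converges, and its limit is zero along the subsequence.\<close>

lemma iterates_converge:
  assumes kkt: "kkt_point f g A B c xs ys zs"
  obtains xb yb zb where "kkt_point f g A B c xb yb zb" "x \<longlonglongrightarrow> xb" "y \<longlonglongrightarrow> yb" "z \<longlonglongrightarrow> zb"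
proof -
  obtain K where K: "\<And>xs ys zs k. kkt_point f g A B c xs ys zs \<Longrightarrow>
      (norm (w k - (xs, ys, zs)))\<^sup>2 \<le> K * \<Psi> xs ys zs k"
    by (rule iterates_dist_le) blast
  have D: "D \<longlonglongrightarrow> 0" by (rule energy_converges[OF kkt])
  note van = increments_vanish[OF D]
  have "convergent (\<lambda>k. K * \<Psi> xs ys zs k)"
    using convergent_mult[OF convergent_const energy_converges(1)[OF kkt]] .
  then obtain M where M': "\<forall>k. norm (K * \<Psi> xs ys zs k) \<le> M"
    using convergent_imp_Bseq BseqE by blast
  have M: "K * \<Psi> xs ys zs k \<le> M" for k using M'[rule_format, of k] by simp
  have "norm (w k) \<le> sqrt M + norm (xs, ys, zs)" for k
  proof -
    have "(norm (w k - (xs, ys, zs)))\<^sup>2 \<le> M" using K[OF kkt] M order_trans by blast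
    then have "norm (w k - (xs, ys, zs)) \<le> sqrt M" by (rule real_le_rsqrt)
    then show ?thesis using norm_triangle_sub[of "w k" "(xs, ys, zs)"] by linarith
  qed
  then have "bounded (range w)" by (auto simp: bounded_iff)
  then obtain l \<phi> where \<phi>: "strict_mono \<phi>" and l: "(w \<circ> \<phi>) \<longlonglongrightarrow> l"
    using bounded_imp_convergent_subsequence by blast
  obtain xb yb zb where lb: "l = (xb, yb, zb)" by (cases l)
  have lim: "(\<lambda>n. x (Suc (\<phi> n))) \<longlonglongrightarrow> xb" "(\<lambda>n. y (Suc (\<phi> n))) \<longlonglongrightarrow> yb"
      "(\<lambda>n. z (Suc (\<phi> n))) \<longlonglongrightarrow> zb"
    using tendsto_fst[OF l] tendsto_fst[OF tendsto_snd[OF l]] tendsto_snd[OF tendsto_snd[OF l]]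
    by (simp_all add: w_def lb o_def)
  have kktb: "kkt_point f g A B c xb yb zb" by (rule cluster_point_kkt[OF D \<phi> lim])
  note sub = LIMSEQ_subseq_LIMSEQ[OF _ \<phi>, unfolded o_def]
  note van\<phi> = van(2,3,7)[THEN sub]
  have linT: "linear (prox_op Pg \<Sigma>g \<sigma> B)" using Tg by (simp add: posdef_def selfadj_def)
  have linS: "linear \<Sigma>f" "linear \<Sigma>g" using \<Sigma>f_psd \<Sigma>g_psd by (auto simp: psd_def selfadj_def)
  note sq = tendsto_sqnorm_op[OF selfadj_linear[OF Pf]] tendsto_sqnorm_op[OF selfadj_linear[OF Pg]]
    tendsto_sqnorm_op[OF linS(1)] tendsto_sqnorm_op[OF linS(2)] tendsto_sqnorm_op[OF linT]
  have "(\<lambda>n. \<Psi> xb yb zb (\<phi> n)) \<longlonglongrightarrow> (norm (zb - zb))\<^sup>2 / (\<tau> * \<sigma>)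
     + (sqnorm_op Pf (xb - xb) + sqnorm_op \<Sigma>f (xb - xb)) + sqnorm_op (prox_op Pg \<Sigma>g \<sigma> B) (yb - yb)
     + \<iota> * (sqnorm_op Pg 0 + 3/4 * sqnorm_op \<Sigma>g 0) + (\<kappa> + 3 * \<epsilon>) * 0 + \<epsilon> * (0 + 0)"
    unfolding \<Psi>_def \<Phi>_def \<omega>_def
    using \<sigma> \<tau> by (intro tendsto_intros sq lim van\<phi> sub[OF LIMSEQ_Suc[OF van(4)]]) auto
  then have "(\<lambda>n. \<Psi> xb yb zb (\<phi> n)) \<longlonglongrightarrow> 0" by (simp add: sqnorm_op_def)
  moreover obtain L where L: "\<Psi> xb yb zb \<longlonglongrightarrow> L"
    using energy_converges(1)[OF kktb] by (auto simp: convergent_def)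
  ultimately have "L = 0" using sub[OF L] LIMSEQ_unique by blast
  then have "(\<lambda>k. K * \<Psi> xb yb zb k) \<longlonglongrightarrow> 0" using tendsto_mult_left[OF L, of K] by simp
  then have "(\<lambda>k. (norm (w k - (xb, yb, zb)))\<^sup>2) \<longlonglongrightarrow> 0"
    by (rule tendsto_zero_squeeze) (simp_all add: K[OF kktb])
  then have "w \<longlonglongrightarrow> (xb, yb, zb)" by (rule LIM_zero_cancel[OF tendsto_zero_of_square])
  then have "(\<lambda>k. x (Suc k)) \<longlonglongrightarrow> xb" "(\<lambda>k. y (Suc k)) \<longlonglongrightarrow> yb" "(\<lambda>k. z (Suc k)) \<longlonglongrightarrow> zb"
    using tendsto_fst[of w] tendsto_fst[OF tendsto_snd[of w]] tendsto_snd[OF tendsto_snd[of w]]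
    by (fastforce simp: w_def)+
  then show ?thesis using that kktb by (simp add: filterlim_sequentially_Suc)
qed

end

section \<open>The algorithm generates such iterates\<close>

text \<open>Stated for an affine constraint term \<open>adjoint A v + h\<close> so as to serve both subproblems.\<close>

lemma subproblem_subgradient:
  fixes f :: "'a::euclidean_space \<Rightarrow> ereal" and A :: "'z::euclidean_space \<Rightarrow> 'a"
  assumes f: "closed_proper_convex f" and A: "linear A" and P: "selfadj P"
    and d: "d \<in> subdiff (\<lambda>v. f v + ereal (b + w \<bullet> (adjoint A v + h) + \<sigma> / 2 * (norm (adjoint A v + h))\<^sup>2
        + 1/2 * sqnorm_op P (v - v0))) x"
  shows "d - A (w + \<sigma> *\<^sub>R (adjoint A x + h)) - P (x - v0) \<in> subdiff f x"
proof -
  define q where "q v = b + w \<bullet> (adjoint A v + h) + \<sigma> / 2 * (norm (adjoint A v + h))\<^sup>2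
    + 1/2 * sqnorm_op P (v - v0)" for v
  define a where "a = A (w + \<sigma> *\<^sub>R (adjoint A x + h)) + P (x - v0)"
  define H where "H u = (1/2) *\<^sub>R (P u + \<sigma> *\<^sub>R A (adjoint A u))" for u
  have linA': "linear (adjoint A)" using A by (rule adjoint_linear)
  have H: "linear H"
    unfolding H_def
    by (intro linear_compose_scale_right linear_compose_add selfadj_linear[OF P]
        linear_compose[OF linA' A, unfolded o_def])
  have q: "q v = q x + a \<bullet> (v - x) + (v - x) \<bullet> H (v - x)" for v
  proof -
    define u where "u = v - x"
    define e where "e = adjoint A u"
    define R where "R = adjoint A x + h"
    have Av: "adjoint A v + h = R + e"
      by (simp add: R_def e_def u_def linear_diff[OF linA'])
    have Pv: "sqnorm_op P (v - v0) = sqnorm_op P (x - v0) + sqnorm_op P u + 2 * (P (x - v0) \<bullet> u)"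
      using sqnorm_op_add[OF P, of "x - v0" u] by (simp add: u_def)
    have a: "a \<bullet> u = w \<bullet> e + \<sigma> * (R \<bullet> e) + P (x - v0) \<bullet> u"
      by (simp add: a_def inner_add_left inner_adjoint[OF A] R_def e_def)
    have Hu: "u \<bullet> H u = 1/2 * sqnorm_op P u + \<sigma> / 2 * (e \<bullet> e)"
      using inner_adjoint[OF A, of e u]
      by (simp add: H_def sqnorm_op_def inner_add_right e_def inner_commute)
    have "(norm (R + e))\<^sup>2 = (norm R)\<^sup>2 + 2 * (R \<bullet> e) + e \<bullet> e"
      unfolding power2_norm_eq_inner by (simp add: inner_add inner_commute)
    then show ?thesis
      unfolding q_def Av Pv u_def[symmetric] a Hu R_def[symmetric]
      by (simp add: inner_add_right algebra_simps)
  qed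
  have "d - a \<in> subdiff f x"
    using d subdiff_minus_quadratic[OF f _ q H] by (simp add: q_def)
  then show ?thesis by (simp add: a_def algebra_simps)
qed

lemma closed_proper_convex_finite:
  assumes "closed_proper_convex f" "x \<in> eff_dom f"
  shows "f x = ereal (real_of_ereal (f x))"
  using assms by (cases "f x") (auto simp: closed_proper_convex_def eff_dom_def)

text \<open>All norms involved are equivalent, so the distance bounds, which are in the metrics of \<open>F\<close> and
  \<open>G\<close>, give perturbations of Euclidean length at most a constant times the tolerance times the
  step. Squaring makes the tolerances summable.\<close>

lemma ieidp_admm_inexact_admm:
  fixes f :: "'x::euclidean_space \<Rightarrow> ereal" and g :: "'y::euclidean_space \<Rightarrow> ereal"
    and A :: "'z::euclidean_space \<Rightarrow> 'x" and B :: "'z \<Rightarrow> 'y"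
  assumes f: "closed_proper_convex f" and g: "closed_proper_convex g"
    and A: "linear A" and B: "linear B"
    and \<Sigma>f: "convexity_operator f \<Sigma>f" and \<Sigma>g: "convexity_operator g \<Sigma>g"
    and alg: "ieidp_admm_C2' f g A B c \<sigma> \<tau> \<Sigma>f \<Sigma>g Pf Pg F G \<mu> \<nu> x y z"
    and Pf: "psd (\<lambda>u. Pf u + (3/8) *\<^sub>R \<Sigma>f u)"
    and Pg: "psd (\<lambda>v. Pg v + (3/8) *\<^sub>R \<Sigma>g v)"
  obtains dx dy m where "inexact_admm f g A B c \<Sigma>f Pf \<Sigma>g Pg \<sigma> \<tau> x y z dx dy m"
proof -
  let ?Tf = "prox_op Pf \<Sigma>f \<sigma> A" and ?Tg = "prox_op Pg \<Sigma>g \<sigma> B"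
  let ?\<phi> = "\<lambda>k. x_objective f g A B c \<sigma> Pf (x k) (y k) (z k)"
  let ?\<psi> = "\<lambda>k. y_objective f g A B c \<sigma> Pg (x (Suc k)) (y k) (z k)"
  have \<sigma>\<tau>: "0 < \<sigma>" "0 < \<tau>" and saP: "selfadj Pf" "selfadj Pg"
    and T: "posdef ?Tf" "posdef ?Tg" and FG: "posdef F" "posdef G" and y0: "y 0 \<in> eff_dom g"
    and z_step: "\<And>k. z (Suc k) = z k + (\<tau> * \<sigma>) *\<^sub>R residual A B c (x (Suc k)) (y (Suc k))"
    and \<phi>ne: "\<And>k. subdiff (?\<phi> k) (x (Suc k)) \<noteq> {}"
    and \<phi>le: "\<And>k. dist_op F 0 (subdiff (?\<phi> k) (x (Suc k))) \<le> \<mu> (Suc k) * norm_op ?Tf (x (Suc k) - x k)"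
    and \<psi>ne: "\<And>k. subdiff (?\<psi> k) (y (Suc k)) \<noteq> {}"
    and \<psi>le: "\<And>k. dist_op G 0 (subdiff (?\<psi> k) (y (Suc k))) \<le> \<nu> (Suc k) * norm_op ?Tg (y (Suc k) - y k)"
    and sm: "summable (\<lambda>k. max ((\<mu> (Suc k))\<^sup>2) ((\<nu> (Suc k))\<^sup>2))"
    using alg unfolding ieidp_admm_C2'_def Let_def by blast+
  have fnm: "f w \<noteq> -\<infinity>" for w using f by (simp add: closed_proper_convex_def)
  have gnm: "g w \<noteq> -\<infinity>" for w using g by (simp add: closed_proper_convex_def)
  have domx: "x (Suc k) \<in> eff_dom f" for k
    using \<phi>ne[of k] gnm[of "y k"]
    by (auto simp: subdiff_def eff_dom_def x_objective_def aug_lagrangian_def)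
  have domy: "y k \<in> eff_dom g" for k
  proof (cases k)
    case (Suc j)
    then show ?thesis using \<psi>ne[of j] fnm[of "x (Suc j)"]
      by (auto simp: subdiff_def eff_dom_def y_objective_def aug_lagrangian_def)
  qed (use y0 in simp)
  obtain CF where CF: "CF > 0" "\<And>v. (norm v)\<^sup>2 \<le> CF * sqnorm_op F v"
    using posdef_norm_bound[OF FG(1)] by blast
  obtain CG where CG: "CG > 0" "\<And>v. (norm v)\<^sup>2 \<le> CG * sqnorm_op G v"
    using posdef_norm_bound[OF FG(2)] by blast
  obtain Cf where Cf: "Cf > 0" "\<And>v. (norm v)\<^sup>2 \<le> Cf * sqnorm_op ?Tf v"
    using posdef_norm_bound[OF T(1)] by blast
  obtain Cg where Cg: "Cg > 0" "\<And>v. (norm v)\<^sup>2 \<le> Cg * sqnorm_op ?Tg v"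
    using posdef_norm_bound[OF T(2)] by blast
  have "\<exists>d. d \<in> subdiff (?\<phi> k) (x (Suc k)) \<and>
      (norm d)\<^sup>2 \<le> CF * (\<mu> (Suc k) * norm_op ?Tf (x (Suc k) - x k))\<^sup>2" for k
    using short_subgradient[OF \<phi>ne FG(1) CF \<phi>le] by metis
  then obtain dx where dx: "\<And>k. dx k \<in> subdiff (?\<phi> k) (x (Suc k))"
      "\<And>k. (norm (dx k))\<^sup>2 \<le> CF * (\<mu> (Suc k) * norm_op ?Tf (x (Suc k) - x k))\<^sup>2"
    by metis
  have "\<exists>d. d \<in> subdiff (?\<psi> k) (y (Suc k)) \<and>
      (norm d)\<^sup>2 \<le> CG * (\<nu> (Suc k) * norm_op ?Tg (y (Suc k) - y k))\<^sup>2" for k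
    using short_subgradient[OF \<psi>ne FG(2) CG \<psi>le] by metis
  then obtain dy where dy: "\<And>k. dy k \<in> subdiff (?\<psi> k) (y (Suc k))"
      "\<And>k. (norm (dy k))\<^sup>2 \<le> CG * (\<nu> (Suc k) * norm_op ?Tg (y (Suc k) - y k))\<^sup>2"
    by metis
  define m where "m k = (CF * Cf + CG * Cg) * max ((\<mu> (Suc k))\<^sup>2) ((\<nu> (Suc k))\<^sup>2)" for k
  have duality: "(d \<bullet> v)\<^sup>2 \<le> m k * sqnorm_op S t * sqnorm_op S v"
    if "(norm d)\<^sup>2 \<le> C * (\<alpha> * norm_op S t)\<^sup>2" "(norm v)\<^sup>2 \<le> C' * sqnorm_op S v" "posdef S"
      "0 < C" "C * C' \<le> CF * Cf + CG * Cg" "0 < C'" "\<alpha>\<^sup>2 \<le> max ((\<mu> (Suc k))\<^sup>2) ((\<nu> (Suc k))\<^sup>2)"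
    for d v t :: "'a::euclidean_space" and S C C' \<alpha> k
  proof -
    have nn: "0 \<le> sqnorm_op S t" "0 \<le> sqnorm_op S v" using that(3) by (auto intro: posdef_nonneg)
    have "(d \<bullet> v)\<^sup>2 \<le> (norm d)\<^sup>2 * (norm v)\<^sup>2"
      using Cauchy_Schwarz_ineq[of d v] by (simp add: power2_norm_eq_inner)
    also have "\<dots> \<le> (C * (\<alpha> * norm_op S t)\<^sup>2) * (C' * sqnorm_op S v)"
      using that nn by (intro mult_mono) auto
    also have "\<dots> = (C * C' * \<alpha>\<^sup>2) * (sqnorm_op S t * sqnorm_op S v)"
      using norm_op_power2[OF that(3), of t] by (simp add: power_mult_distrib)
    also have "\<dots> \<le> m k * (sqnorm_op S t * sqnorm_op S v)"
      unfolding m_def using that CF CG Cf Cg nn by (intro mult_right_mono mult_mono) auto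
    finally show ?thesis by (simp add: mult.assoc)
  qed
  have "inexact_admm f g A B c \<Sigma>f Pf \<Sigma>g Pg \<sigma> \<tau> x y z dx dy m"
  proof (rule inexact_admm.intro)
    show "closed_proper_convex f" "closed_proper_convex g" "linear A" "linear B"
      "convexity_operator f \<Sigma>f" "convexity_operator g \<Sigma>g" "0 < \<sigma>" "0 < \<tau>" "selfadj Pf" "selfadj Pg"
      "psd (\<lambda>u. Pf u + (3/8) *\<^sub>R \<Sigma>f u)" "psd (\<lambda>v. Pg v + (3/8) *\<^sub>R \<Sigma>g v)"
      "posdef ?Tf" "posdef ?Tg" by fact+
    show "z (Suc k) = z k + (\<tau> * \<sigma>) *\<^sub>R residual A B c (x (Suc k)) (y (Suc k))" for k by fact
    show "dx k - A (z k + \<sigma> *\<^sub>R residual A B c (x (Suc k)) (y k)) - Pf (x (Suc k) - x k)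
        \<in> subdiff f (x (Suc k))" for k
    proof -
      define b where "b = real_of_ereal (g (y k))"
      have gy: "g (y k) = ereal b" unfolding b_def by (rule closed_proper_convex_finite[OF g domy])
      have res: "residual A B c v (y k) = adjoint A v + (adjoint B (y k) - c)" for v
        by (simp add: residual_def)
      have eq: "?\<phi> k = (\<lambda>v. f v + ereal (b + z k \<bullet> (adjoint A v + (adjoint B (y k) - c))
          + \<sigma> / 2 * (norm (adjoint A v + (adjoint B (y k) - c)))\<^sup>2 + 1/2 * sqnorm_op Pf (v - x k)))"
        (is "_ = ?rhs")
      proof
        fix v show "?\<phi> k v = ?rhs v"
          unfolding x_objective_def aug_lagrangian_def res gy
          by (cases "f v") simp_all
      qed
      show ?thesis
        using subproblem_subgradient[OF f A saP(1) dx(1)[of k, unfolded eq]] unfolding res .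
    qed
    show "dy k - B (z k + \<sigma> *\<^sub>R residual A B c (x (Suc k)) (y (Suc k))) - Pg (y (Suc k) - y k)
        \<in> subdiff g (y (Suc k))" for k
    proof -
      define b where "b = real_of_ereal (f (x (Suc k)))"
      have fx: "f (x (Suc k)) = ereal b"
        unfolding b_def by (rule closed_proper_convex_finite[OF f domx])
      have res: "residual A B c (x (Suc k)) v = adjoint B v + (adjoint A (x (Suc k)) - c)" for v
        by (simp add: residual_def)
      have eq: "?\<psi> k = (\<lambda>v. g v + ereal (b + z k \<bullet> (adjoint B v + (adjoint A (x (Suc k)) - c))
          + \<sigma> / 2 * (norm (adjoint B v + (adjoint A (x (Suc k)) - c)))\<^sup>2 + 1/2 * sqnorm_op Pg (v - y k)))"
        (is "_ = ?rhs")
      proof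
        fix v show "?\<psi> k v = ?rhs v"
          unfolding y_objective_def aug_lagrangian_def res fx
          by (cases "g v") simp_all
      qed
      show ?thesis
        using subproblem_subgradient[OF g B saP(2) dy(1)[of k, unfolded eq]] unfolding res .
    qed
    show "summable m" unfolding m_def[abs_def] by (intro summable_mult sm)
    show "0 \<le> m k" for k
      unfolding m_def using CF CG Cf Cg by (intro mult_nonneg_nonneg) (auto simp: le_max_iff_disj)
    show "(dx k \<bullet> v)\<^sup>2 \<le> m k * sqnorm_op ?Tf (x (Suc k) - x k) * sqnorm_op ?Tf v" for k v
      by (rule duality[OF dx(2) Cf(2) T(1)]) (use CF CG Cf Cg in auto)
    show "(dy k \<bullet> v)\<^sup>2 \<le> m k * sqnorm_op ?Tg (y (Suc k) - y k) * sqnorm_op ?Tg v" for k v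
      by (rule duality[OF dy(2) Cg(2) T(2)]) (use CF CG Cf Cg in auto)
  qed
  then show ?thesis using that by blast
qed

theorem theorem4p3:
  fixes f :: "'x::euclidean_space \<Rightarrow> ereal"
    and g :: "'y::euclidean_space \<Rightarrow> ereal"
    and A :: "'z::euclidean_space \<Rightarrow> 'x"
    and B :: "'z \<Rightarrow> 'y"
    and c :: 'z
    and \<Sigma>f Pf F :: "'x \<Rightarrow> 'x"
    and \<Sigma>g Pg G :: "'y \<Rightarrow> 'y"
    and \<sigma> \<tau> \<gamma> c2 :: real
    and \<mu> \<nu> :: "nat \<Rightarrow> real"
    and x :: "nat \<Rightarrow> 'x" and y :: "nat \<Rightarrow> 'y" and z :: "nat \<Rightarrow> 'z"
  assumes f: "closed_proper_convex f" and g: "closed_proper_convex g"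
    and A: "linear A" and B: "linear B"
    and \<Sigma>f: "convexity_operator f \<Sigma>f" and \<Sigma>g: "convexity_operator g \<Sigma>g"
    and algorithm: "ieidp_admm_C2' f g A B c \<sigma> \<tau> \<Sigma>f \<Sigma>g Pf Pg F G \<mu> \<nu> x y z"
    and \<gamma>: "\<gamma> \<ge> 360"
    and tolerance: "\<And>k. k \<ge> 1 \<Longrightarrow> max ((\<mu> k)\<^sup>2) ((\<nu> k)\<^sup>2)
          \<le> min (1 / (8 * \<gamma>)) ((2 - \<tau> - 2.5 * inverse \<gamma>) / (3 * \<gamma>))"
    and assmA: "assumption_A f g A B c"
    and Pf: "psd (\<lambda>u. Pf u + (3/8) *\<^sub>R \<Sigma>f u)"
    and Pg: "psd (\<lambda>v. Pg v + (3/8) *\<^sub>R \<Sigma>g v)"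
    and c2: "c2 = \<bar>2 - \<tau> - 6.5 * inverse \<gamma>
                    - max (1 - \<tau>) ((\<tau> - 1) / 1.6) / (1 - 10 * inverse \<gamma>)\<bar>"
    and step_length: "(0 < \<tau> \<and> \<tau> \<le> 1.6) \<or>
          (1.6 < \<tau> \<and> \<tau> < 2 \<and>
           summable (\<lambda>k. \<bar>2.6 - 1.6 * \<tau>\<bar> * (norm (residual A B c (x k) (y k)))\<^sup>2
              + c2 * (norm_op (prox_op Pg \<Sigma>g \<sigma> B) (y (Suc k) - y k))\<^sup>2))"
  shows "(\<exists>xs ys. primal_optimal f g A B c xs ys \<and> (\<lambda>k. (x k, y k)) \<longlonglongrightarrow> (xs, ys)) \<and>
         (\<exists>zs. dual_optimal f g A B c zs \<and> z \<longlonglongrightarrow> zs)"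
proof -
  obtain dx dy m where "inexact_admm f g A B c \<Sigma>f Pf \<Sigma>g Pg \<sigma> \<tau> x y z dx dy m"
    using ieidp_admm_inexact_admm[OF f g A B \<Sigma>f \<Sigma>g algorithm Pf Pg] .
  then interpret inexact_admm f g A B c \<Sigma>f Pf \<Sigma>g Pg \<sigma> \<tau> x y z dx dy m .
  have "\<exists>e \<kappa> \<iota> s. cross_bound e \<kappa> \<iota> s"
    using step_length
  proof (elim disjE conjE)
    assume "\<tau> \<le> 1.6"
    then show ?thesis by (intro cross_bound_small_step) simp
  next
    assume \<tau>2: "1.6 < \<tau>" "\<tau> < 2"
      and sum: "summable (\<lambda>k. \<bar>2.6 - 1.6 * \<tau>\<bar> * (norm (residual A B c (x k) (y k)))\<^sup>2
              + c2 * (norm_op (prox_op Pg \<Sigma>g \<sigma> B) (y (Suc k) - y k))\<^sup>2)"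
    define a where "a = \<bar>2.6 - 1.6 * \<tau>\<bar>"
    have sum': "summable (\<lambda>k. a * (norm (r k))\<^sup>2 + c2 * (q k + \<beta> k))"
      using sum by (simp add: a_def r_def norm_op_power2[OF Tg] Tg_\<Delta>y[unfolded \<Delta>y_def])
    have c2nn: "0 \<le> c2" "0 \<le> a" by (simp_all add: c2 a_def)
    (* The two weights do not vanish together: a = 0 only for \<tau> = 13/8, and there c2 is positive. *)
    show ?thesis
    proof (cases "a = 0")
      case False
      then have a: "0 < a" using c2nn by simp
      have "summable (\<lambda>k. \<sigma> / a * (a * (norm (r k))\<^sup>2 + c2 * (q k + \<beta> k)))"
        using sum' by (rule summable_mult)
      then have "summable \<rho>"
      proof (rule summable_comparison_test'[where N = 0])
        fix k
        have "0 \<le> \<sigma> / a * (c2 * (q k + \<beta> k))" using a \<sigma> c2nn by simp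
        then show "norm (\<rho> k) \<le> \<sigma> / a * (a * (norm (r k))\<^sup>2 + c2 * (q k + \<beta> k))"
          using a \<sigma> by (simp add: \<rho>_def distrib_left)
      qed
      then show ?thesis by (rule cross_bound_summable_residual[OF \<tau>2(2)])
    next
      case True
      then have \<tau>: "\<tau> = 13/8" by (simp add: a_def)
      have i: "0 < inverse \<gamma>" "inverse \<gamma> \<le> 1/360" using \<gamma> by (auto simp: field_simps)
      have "25/64 \<le> (25/64) / (1 - 10 * inverse \<gamma>)"
        using i by (simp add: le_divide_eq)
      moreover have mx: "max (1 - 13/8) ((13/8 - 1) / 1.6) = (25/64 :: real)" by simp
      ultimately have "2 - \<tau> - 6.5 * inverse \<gamma>
          - max (1 - \<tau>) ((\<tau> - 1) / 1.6) / (1 - 10 * inverse \<gamma>) < 0"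
        using i(1) unfolding \<tau> mx by linarith
      then have c2p: "0 < c2" unfolding c2 by simp
      have "summable (\<lambda>k. 1 / c2 * (a * (norm (r k))\<^sup>2 + c2 * (q k + \<beta> k)))"
        using sum' by (rule summable_mult)
      then have "summable (\<lambda>k. q k + \<beta> k)" using True c2p by simp
      then show ?thesis by (rule cross_bound_summable_displacement[OF \<tau>2(2)])
    qed
  qed
  then obtain e \<kappa> \<iota> s where "cross_bound e \<kappa> \<iota> s" by blast
  then interpret coupled_admm f g A B c \<Sigma>f Pf \<Sigma>g Pg \<sigma> \<tau> x y z dx dy m e \<kappa> \<iota> s
    by unfold_locales
  obtain x0 y0 z0 where "kkt_point f g A B c x0 y0 z0"
    using kkt_point_exists[OF f g A B assmA] .
  then obtain xs ys zs where kkt: "kkt_point f g A B c xs ys zs"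
    and lim: "x \<longlonglongrightarrow> xs" "y \<longlonglongrightarrow> ys" "z \<longlonglongrightarrow> zs"
    by (rule iterates_converge)
  show ?thesis
    using kkt_point_optimal[OF A B kkt] tendsto_Pair[OF lim(1,2)] lim(3) by blast
qed

end
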